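(* Let $X$ be an infinite-dimensional Banach space over $\mathbb{K}\in\{\mathbb{R},\mathbb{C}\}$, let $0<\tau\le 1$, and let $(x_i)_{i\in\mathbb{N}}\subseteq X$ be a fundamental minimal system which is WSG($\tau$) (weak semi-greedy with weakness parameter $\tau$) with constant $K$. The following are equivalent: (i) $(x_i)_i$ is almost greedy. (ii) $(x_i)_i$ is quasi-greedy. (iii) $(x_i)_i$ is a Markushevich basis. (iv) $(x_i)_i$ has the finite dimensional separation property. If any (and thus all) of these conditions holds, then $(x_i)_i$ has second quasi-greedy constant $K_{2q}\le M_{fs}K+M_{fs}(M_{fs}+1)K^{2}\tau^{-2}$ and hyperdemocracy constant $K_{hd}\le M_{fs}(M_{fs}+1)K^2\tau^{-2}$, where $M_{fs}$ is the finite dimensional separation constant of $(x_i)_i$.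
   Context: $X'$ is the dual of $X$; $[\,\cdot\,]$ denotes linear span. A sequence $(x_i)_i\subseteq X$ is fundamental if $X=\overline{[x_i:i\in\mathbb{N}]}$; it is a minimal system if there is a sequence $(x_i')_i\subseteq X'$ with $x_i'(x_j)=\delta_{ij}$ (biorthogonal functionals, unique when $(x_i)_i$ is fundamental). A fundamental minimal system is a Markushevich basis if $(x_i')_i$ is total: $x_i'(x)=0$ for all $i$ implies $x=0$. It has bounded coordinates if $\sup_i\|x_i'\|<\infty$. $\mathrm{supp}(x)=\{i: x_i'(x)\neq 0\}$. For finite $A\subseteq\mathbb{N}$, $P_A(x)=\sum_{i\in A}x_i'(x)x_i$ and $|A|$ is the cardinality of $A$. Greedy approximations (bounded coordinates): a decreasing ordering for $x$ is an injective $\varrho:\mathbb{N}\to\mathbb{N}$ with $\mathrm{supp}(x)\subseteq\varrho(\mathbb{N})$ and $|x'_{\varrho(i)}(x)|\ge|x'_{\varrho(j)}(x)|$ for $i\le j$; the greedy ordering $\rho(x,\cdot)$ is the decreasing ordering for which $i<j$ and $|x'_{\rho(x,i)}(x)|=|x'_{\rho(x,j)}(x)|$ imply $\rho(x,i)<\rho(x,j)$. $\mathcal{G}_m(x)=\sum_{i=1}^m x'_{\rho(x,i)}(x)x_{\rho(x,i)}$, $\mathcal{G}_0(x)=0$. Quasi-greedy: a fundamental minimal system with bounded coordinates such that for some $M>0$, $\|\mathcal{G}_m(x)\|\le M\|x\|$ for all $x\in X$, $m\in\mathbb{N}$; equivalently, for some $M>0$, $\|x-\mathcal{G}_m(x)\|\le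 M\|x\|$ for all $x,m$. The minimum $M$ in the last inequality is the second quasi-greedy constant $K_{2q}$. Almost greedy: bounded coordinates and, for some $M>0$, $\|x-\mathcal{G}_m(x)\|\le M\widetilde\sigma_m(x)$ for all $x\in X$, $m\in\mathbb{N}_0$, where $\widetilde\sigma_m(x)=\inf\{\|x-P_A(x)\|:|A|\le m\}$. Hyperdemocratic: for some $K'>0$, $\|\sum_{i\in A}a_ix_i\|\le K'\|\sum_{j\in B}b_jx_j\|$ for all finite $A,B\subseteq\mathbb{N}$ with $|A|\le|B|$ and all scalars with $|a_i|\le|b_j|$ for every $i\in A,j\in B$; the minimum $K'$ is the hyperdemocracy constant $K_{hd}$. Weak thresholding set: given $0<\tau\le1$, $x\in X$, $m\in\mathbb{N}$, an $m$-weak thresholding set for $x$ with weakness parameter $\tau$ is a set $\mathcal{W}^\tau(x,m)\subseteq\mathbb{N}$ of cardinality $m$ with $|x_i'(x)|\ge\tau|x_j'(x)|$ for all $i\in\mathcal{W}^\tau(x,m)$, $j\notin\mathcal{W}^\tau(x,m)$. WSG($\tau$) with constant $K$: for every $x\in X$, $m\in\mathbb{N}$ there are an $m$-weak thresholding set $\mathcal{W}^\tau(x,m)$ and $z\in[x_i:i\in\mathcal{W}^\tau(x,m)]$ with $\|x-z\|\le K\sigma_m(x)$, where $\sigma_m(x)=\inf\{\|x-y\|: |\mathrm{supp}(y)|\le m,\ y=P_{\mathrm{supp}(y)}(y)\}$. Finite dimensional separation property (FDSP) of a sequence $(u_i)_i\subseteq X$: there is $M>0$ such that for every separable subspace $Z\subset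 X$ and every $\epsilon>0$ there is a basic subsequence $(u_{i_k})_k$ with basis constant no greater than $M+\epsilon$ such that for every finite dimensional subspace $F\subset Z$ there is $j_F\in\mathbb{N}$ with $\|x\|\le(M+\epsilon)\|x+z\|$ for all $x\in F$ and all $z\in\overline{[u_{i_k}:k>j_F]}$. The minimum such $M$ is the finite dimensional separation constant $M_{fs}$ of $(u_i)_i$. *)

theory Defs
  imports "HOL-Analysis.Analysis"
begin

text \<open>
  Scalar fields \<open>\<real>\<close> and \<open>\<complex>\<close>: a field in this class is, up to isometric isomorphism, one of
  the two, embedded in the complex numbers with image \<open>\<real>\<close> or everything.
\<close>

class real_or_complex_field = real_normed_field +
  assumes real_or_complex:
    "\<exists>\<phi>::'a \<Rightarrow> complex.
       \<phi> 1 = 1 \<and> (\<forall>a b. \<phi> (a + b) = \<phi> a + \<phi> b) \<and> (\<forall>a b. \<phi> (a * b) = \<phi> a * \<phi> b) \<and>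
       (\<forall>r a. \<phi> (r *\<^sub>R a) = r *\<^sub>R \<phi> a) \<and> (\<forall>a. norm (\<phi> a) = norm a) \<and>
       (range \<phi> = \<real> \<or> range \<phi> = UNIV)"

instance real :: real_or_complex_field
proof
  have "range complex_of_real = \<real>"
    by (simp add: Reals_def)
  then show "\<exists>\<phi>::real \<Rightarrow> complex.
       \<phi> 1 = 1 \<and> (\<forall>a b. \<phi> (a + b) = \<phi> a + \<phi> b) \<and> (\<forall>a b. \<phi> (a * b) = \<phi> a * \<phi> b) \<and>
       (\<forall>r a. \<phi> (r *\<^sub>R a) = r *\<^sub>R \<phi> a) \<and> (\<forall>a. norm (\<phi> a) = norm a) \<and>
       (range \<phi> = \<real> \<or> range \<phi> = UNIV)"
    by (intro exI[of _ complex_of_real]) (simp add: scaleR_conv_of_real)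
qed

instance complex :: real_or_complex_field
  by standard (rule exI[of _ id], simp)

text \<open>
  The class \<^class>\<open>banach\<close> only provides real Banach spaces. A Banach space over \<open>'k\<close> is a type
  of that class with a multiplication by scalars from \<open>'k\<close> that extends the real one and for which
  the norm is homogeneous; if \<open>'k\<close> is \<open>\<real>\<close>, then \<open>scl\<close> is necessarily the given real one.
\<close>

locale banach_space_over = vector_space scl
  for scl :: "'k::real_or_complex_field \<Rightarrow> 'x::banach \<Rightarrow> 'x" +
  assumes scl_of_real: "scl (of_real r) v = r *\<^sub>R v"
    and norm_scl: "norm (scl c v) = norm c * norm v"

lemma banach_space_over_scaleR: "banach_space_over (scaleR :: real \<Rightarrow> 'x::banach \<Rightarrow> 'x)"
  by unfold_locales (simp_all add: scaleR_add_right scaleR_add_left)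

lemma banach_space_over_complex: "banach_space_over ((*) :: complex \<Rightarrow> complex \<Rightarrow> complex)"
  by unfold_locales (simp_all add: distrib_left distrib_right norm_mult scaleR_conv_of_real)

definition finite_dim_subspace :: "('k::real_or_complex_field \<Rightarrow> 'x::banach \<Rightarrow> 'x) \<Rightarrow> 'x set \<Rightarrow> bool"
  where "finite_dim_subspace scl F \<longleftrightarrow>
    module.subspace scl F \<and> (\<exists>B. finite B \<and> F = module.span scl B)"

definition closed_span :: "('k::real_or_complex_field \<Rightarrow> 'x::banach \<Rightarrow> 'x) \<Rightarrow> 'x set \<Rightarrow> 'x set"
  where "closed_span scl S = closure (module.span scl S)"


subsection \<open>Minimal systems\<close>

text \<open>
  The dual norm of a functional \<open>f\<close> is \<^term>\<open>onorm f\<close>. Sequences are indexed from 0; all that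
  matters about the index set are its order and the cardinalities of its subsets.
\<close>

definition dual_functional ::
  "('k::real_or_complex_field \<Rightarrow> 'x::banach \<Rightarrow> 'x) \<Rightarrow> ('x \<Rightarrow> 'k) \<Rightarrow> bool"
  where "dual_functional scl f \<longleftrightarrow> bounded_linear f \<and> (\<forall>c v. f (scl c v) = c * f v)"

definition biorthogonal ::
  "('k::real_or_complex_field \<Rightarrow> 'x::banach \<Rightarrow> 'x) \<Rightarrow> (nat \<Rightarrow> 'x) \<Rightarrow> (nat \<Rightarrow> 'x \<Rightarrow> 'k) \<Rightarrow> bool"
  where "biorthogonal scl x x' \<longleftrightarrow>
    (\<forall>i. dual_functional scl (x' i)) \<and> (\<forall>i j. x' i (x j) = (if i = j then 1 else 0))"

definition fundamental ::
  "('k::real_or_complex_field \<Rightarrow> 'x::banach \<Rightarrow> 'x) \<Rightarrow> (nat \<Rightarrow> 'x) \<Rightarrow> bool"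
  where "fundamental scl x \<longleftrightarrow> closed_span scl (range x) = UNIV"

definition minimal_system ::
  "('k::real_or_complex_field \<Rightarrow> 'x::banach \<Rightarrow> 'x) \<Rightarrow> (nat \<Rightarrow> 'x) \<Rightarrow> bool"
  where "minimal_system scl x \<longleftrightarrow> (\<exists>x'. biorthogonal scl x x')"

definition fundamental_minimal_system ::
  "('k::real_or_complex_field \<Rightarrow> 'x::banach \<Rightarrow> 'x) \<Rightarrow> (nat \<Rightarrow> 'x) \<Rightarrow> bool"
  where "fundamental_minimal_system scl x \<longleftrightarrow> fundamental scl x \<and> minimal_system scl x"

text \<open>The biorthogonal functionals; see \<open>biorthogonal_coord\<close> below.\<close>

definition coord ::
  "('k::real_or_complex_field \<Rightarrow> 'x::banach \<Rightarrow> 'x) \<Rightarrow> (nat \<Rightarrow> 'x) \<Rightarrow> nat \<Rightarrow> 'x \<Rightarrow> 'k"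
  where "coord scl x = (THE x'. biorthogonal scl x x')"

lemma biorthogonal_unique:
  assumes "banach_space_over scl" and "fundamental scl x"
    and f: "biorthogonal scl x f" and g: "biorthogonal scl x g"
  shows "f = g"
proof (intro ext)
  fix i v
  interpret V: banach_space_over scl by fact
  have lin: "bounded_linear (f i)" "bounded_linear (g i)"
    using f g by (simp_all add: biorthogonal_def dual_functional_def)
  have add: "f i (a + b) = f i a + f i b" "g i (a + b) = g i a + g i b" for a b
    using lin by (metis linear_simps(1))+
  have zero: "f i 0 = 0" "g i 0 = 0"
    using lin[THEN bounded_linear.linear] by (simp_all add: linear_0)
  have hom: "f i (scl c a) = c * f i a" "g i (scl c a) = c * g i a" for c a
    using f g by (simp_all add: biorthogonal_def dual_functional_def)
  have sub: "V.subspace {a. f i a = g i a}"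
    by (rule V.subspaceI) (simp_all add: add zero hom)
  have "range x \<subseteq> {a. f i a = g i a}"
    using f g by (auto simp: biorthogonal_def)
  then have "V.span (range x) \<subseteq> {a. f i a = g i a}"
    using sub by (rule V.span_minimal)
  moreover have "closed {a. f i a = g i a}"
    using lin by (intro closed_Collect_eq linear_continuous_on)
  ultimately have "closure (V.span (range x)) \<subseteq> {a. f i a = g i a}"
    by (rule closure_minimal)
  then show "f i v = g i v"
    using assms(2) by (auto simp: fundamental_def closed_span_def)
qed

lemma biorthogonal_coord:
  assumes "banach_space_over scl" and "fundamental_minimal_system scl x"
  shows "biorthogonal scl x (coord scl x)"
proof -
  obtain x' where x': "biorthogonal scl x x'" "fundamental scl x"
    using assms(2) unfolding fundamental_minimal_system_def minimal_system_def by blast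
  show ?thesis
    unfolding coord_def
    by (rule theI[where P = "biorthogonal scl x", OF x'(1)])
      (rule biorthogonal_unique[OF assms(1) x'(2) _ x'(1)])
qed

definition total ::
  "('k::real_or_complex_field \<Rightarrow> 'x::banach \<Rightarrow> 'x) \<Rightarrow> (nat \<Rightarrow> 'x) \<Rightarrow> bool"
  where "total scl x \<longleftrightarrow> (\<forall>v. (\<forall>i. coord scl x i v = 0) \<longrightarrow> v = 0)"

definition markushevich_basis ::
  "('k::real_or_complex_field \<Rightarrow> 'x::banach \<Rightarrow> 'x) \<Rightarrow> (nat \<Rightarrow> 'x) \<Rightarrow> bool"
  where "markushevich_basis scl x \<longleftrightarrow> fundamental_minimal_system scl x \<and> total scl x"

definition bounded_coordinates ::
  "('k::real_or_complex_field \<Rightarrow> 'x::banach \<Rightarrow> 'x) \<Rightarrow> (nat \<Rightarrow> 'x) \<Rightarrow> bool"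
  where "bounded_coordinates scl x \<longleftrightarrow> bdd_above (range (\<lambda>i. onorm (coord scl x i)))"

definition supp ::
  "('k::real_or_complex_field \<Rightarrow> 'x::banach \<Rightarrow> 'x) \<Rightarrow> (nat \<Rightarrow> 'x) \<Rightarrow> 'x \<Rightarrow> nat set"
  where "supp scl x v = {i. coord scl x i v \<noteq> 0}"

definition proj ::
  "('k::real_or_complex_field \<Rightarrow> 'x::banach \<Rightarrow> 'x) \<Rightarrow> (nat \<Rightarrow> 'x) \<Rightarrow> nat set \<Rightarrow> 'x \<Rightarrow> 'x"
  where "proj scl x A v = (\<Sum>i\<in>A. scl (coord scl x i v) (x i))"


subsection \<open>Greedy approximation\<close>

definition decreasing_ordering ::
  "('k::real_or_complex_field \<Rightarrow> 'x::banach \<Rightarrow> 'x) \<Rightarrow> (nat \<Rightarrow> 'x) \<Rightarrow> 'x \<Rightarrow> (nat \<Rightarrow> nat) \<Rightarrow> bool"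
  where "decreasing_ordering scl x v \<rho> \<longleftrightarrow>
    inj \<rho> \<and> supp scl x v \<subseteq> range \<rho> \<and>
    (\<forall>i j. i \<le> j \<longrightarrow> norm (coord scl x (\<rho> i) v) \<ge> norm (coord scl x (\<rho> j) v))"

definition is_greedy_ordering ::
  "('k::real_or_complex_field \<Rightarrow> 'x::banach \<Rightarrow> 'x) \<Rightarrow> (nat \<Rightarrow> 'x) \<Rightarrow> 'x \<Rightarrow> (nat \<Rightarrow> nat) \<Rightarrow> bool"
  where "is_greedy_ordering scl x v \<rho> \<longleftrightarrow>
    decreasing_ordering scl x v \<rho> \<and>
    (\<forall>i j. i < j \<and> norm (coord scl x (\<rho> i) v) = norm (coord scl x (\<rho> j) v) \<longrightarrow> \<rho> i < \<rho> j)"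

text \<open>
  If \<open>v\<close> has finite support, a greedy ordering is only determined on the support of \<open>v\<close>; the
  remaining indices have coefficient 0, so the choice made here does not affect \<open>greedy_approx\<close>.
\<close>

definition greedy_ordering ::
  "('k::real_or_complex_field \<Rightarrow> 'x::banach \<Rightarrow> 'x) \<Rightarrow> (nat \<Rightarrow> 'x) \<Rightarrow> 'x \<Rightarrow> nat \<Rightarrow> nat"
  where "greedy_ordering scl x v = (SOME \<rho>. is_greedy_ordering scl x v \<rho>)"

definition greedy_approx ::
  "('k::real_or_complex_field \<Rightarrow> 'x::banach \<Rightarrow> 'x) \<Rightarrow> (nat \<Rightarrow> 'x) \<Rightarrow> nat \<Rightarrow> 'x \<Rightarrow> 'x"
  where "greedy_approx scl x m v =
    (\<Sum>i<m. scl (coord scl x (greedy_ordering scl x v i) v) (x (greedy_ordering scl x v i)))"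

definition quasi_greedy ::
  "('k::real_or_complex_field \<Rightarrow> 'x::banach \<Rightarrow> 'x) \<Rightarrow> (nat \<Rightarrow> 'x) \<Rightarrow> bool"
  where "quasi_greedy scl x \<longleftrightarrow>
    fundamental_minimal_system scl x \<and> bounded_coordinates scl x \<and>
    (\<exists>M>0. \<forall>v. \<forall>m\<ge>1. norm (greedy_approx scl x m v) \<le> M * norm v)"

text \<open>
  This constant and the two constants further below are minima of the sets of admissible constants,
  expressed as infima. They are meaningful only if the respective set is nonempty.
\<close>

definition second_quasi_greedy_constant ::
  "('k::real_or_complex_field \<Rightarrow> 'x::banach \<Rightarrow> 'x) \<Rightarrow> (nat \<Rightarrow> 'x) \<Rightarrow> real"
  where "second_quasi_greedy_constant scl x =
    Inf {M. M > 0 \<and> (\<forall>v. \<forall>m\<ge>1. norm (v - greedy_approx scl x m v) \<le> M * norm v)}"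

definition proj_error ::
  "('k::real_or_complex_field \<Rightarrow> 'x::banach \<Rightarrow> 'x) \<Rightarrow> (nat \<Rightarrow> 'x) \<Rightarrow> nat \<Rightarrow> 'x \<Rightarrow> real"
  where "proj_error scl x m v = Inf {norm (v - proj scl x A v) | A. finite A \<and> card A \<le> m}"

definition almost_greedy ::
  "('k::real_or_complex_field \<Rightarrow> 'x::banach \<Rightarrow> 'x) \<Rightarrow> (nat \<Rightarrow> 'x) \<Rightarrow> bool"
  where "almost_greedy scl x \<longleftrightarrow>
    fundamental_minimal_system scl x \<and> bounded_coordinates scl x \<and>
    (\<exists>M>0. \<forall>v m. norm (v - greedy_approx scl x m v) \<le> M * proj_error scl x m v)"

definition hyperdemocratic_with ::
  "('k::real_or_complex_field \<Rightarrow> 'x::banach \<Rightarrow> 'x) \<Rightarrow> (nat \<Rightarrow> 'x) \<Rightarrow> real \<Rightarrow> bool"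
  where "hyperdemocratic_with scl x K' \<longleftrightarrow>
    (\<forall>A B a b. finite A \<and> finite B \<and> card A \<le> card B \<and> (\<forall>i\<in>A. \<forall>j\<in>B. norm (a i) \<le> norm (b j)) \<longrightarrow>
       norm (\<Sum>i\<in>A. scl (a i) (x i)) \<le> K' * norm (\<Sum>j\<in>B. scl (b j) (x j)))"

definition hyperdemocratic ::
  "('k::real_or_complex_field \<Rightarrow> 'x::banach \<Rightarrow> 'x) \<Rightarrow> (nat \<Rightarrow> 'x) \<Rightarrow> bool"
  where "hyperdemocratic scl x \<longleftrightarrow> (\<exists>K'>0. hyperdemocratic_with scl x K')"

definition hyperdemocracy_constant ::
  "('k::real_or_complex_field \<Rightarrow> 'x::banach \<Rightarrow> 'x) \<Rightarrow> (nat \<Rightarrow> 'x) \<Rightarrow> real"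
  where "hyperdemocracy_constant scl x = Inf {K'. K' > 0 \<and> hyperdemocratic_with scl x K'}"


subsection \<open>Weak semi-greedy systems\<close>

definition weak_thresholding_set ::
  "('k::real_or_complex_field \<Rightarrow> 'x::banach \<Rightarrow> 'x) \<Rightarrow> (nat \<Rightarrow> 'x) \<Rightarrow> real \<Rightarrow> 'x \<Rightarrow> nat \<Rightarrow> nat set \<Rightarrow> bool"
  where "weak_thresholding_set scl x \<tau> v m W \<longleftrightarrow>
    finite W \<and> card W = m \<and>
    (\<forall>i\<in>W. \<forall>j. j \<notin> W \<longrightarrow> norm (coord scl x i v) \<ge> \<tau> * norm (coord scl x j v))"

definition best_error ::
  "('k::real_or_complex_field \<Rightarrow> 'x::banach \<Rightarrow> 'x) \<Rightarrow> (nat \<Rightarrow> 'x) \<Rightarrow> nat \<Rightarrow> 'x \<Rightarrow> real"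
  where "best_error scl x m v =
    Inf {norm (v - y) | y. finite (supp scl x y) \<and> card (supp scl x y) \<le> m \<and>
                           y = proj scl x (supp scl x y) y}"

definition weak_semi_greedy ::
  "('k::real_or_complex_field \<Rightarrow> 'x::banach \<Rightarrow> 'x) \<Rightarrow> (nat \<Rightarrow> 'x) \<Rightarrow> real \<Rightarrow> real \<Rightarrow> bool"
  where "weak_semi_greedy scl x \<tau> K \<longleftrightarrow>
    (\<forall>v. \<forall>m\<ge>1. \<exists>W z. weak_thresholding_set scl x \<tau> v m W \<and> z \<in> module.span scl (x ` W) \<and>
                     norm (v - z) \<le> K * best_error scl x m v)"


subsection \<open>Basic sequences and finite dimensional separation\<close>

definition basic_sequence ::
  "('k::real_or_complex_field \<Rightarrow> 'x::banach \<Rightarrow> 'x) \<Rightarrow> (nat \<Rightarrow> 'x) \<Rightarrow> bool"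
  where "basic_sequence scl u \<longleftrightarrow>
    (\<forall>y \<in> closed_span scl (range u). \<exists>!a. (\<lambda>k. scl (a k) (u k)) sums y)"

definition basis_coeff ::
  "('k::real_or_complex_field \<Rightarrow> 'x::banach \<Rightarrow> 'x) \<Rightarrow> (nat \<Rightarrow> 'x) \<Rightarrow> 'x \<Rightarrow> nat \<Rightarrow> 'k"
  where "basis_coeff scl u y = (THE a. (\<lambda>k. scl (a k) (u k)) sums y)"

text \<open>
  The supremum over \<open>n\<close> of the operator norms of the partial sum projections on the closed span.
  It is taken in the extended reals, so that no boundedness has to be known in advance.
\<close>

definition basis_constant ::
  "('k::real_or_complex_field \<Rightarrow> 'x::banach \<Rightarrow> 'x) \<Rightarrow> (nat \<Rightarrow> 'x) \<Rightarrow> ereal"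
  where "basis_constant scl u =
    (SUP n. SUP y \<in> {y \<in> closed_span scl (range u). norm y \<le> 1}.
       ereal (norm (\<Sum>k<n. scl (basis_coeff scl u y k) (u k))))"

definition fds_with ::
  "('k::real_or_complex_field \<Rightarrow> 'x::banach \<Rightarrow> 'x) \<Rightarrow> (nat \<Rightarrow> 'x) \<Rightarrow> real \<Rightarrow> bool"
  where "fds_with scl u M \<longleftrightarrow>
    (\<forall>Z \<epsilon>. module.subspace scl Z \<and> separable_space (top_of_set Z) \<and> \<epsilon> > 0 \<longrightarrow>
      (\<exists>i::nat \<Rightarrow> nat. strict_mono i \<and> basic_sequence scl (u \<circ> i) \<and>
         basis_constant scl (u \<circ> i) \<le> ereal (M + \<epsilon>) \<and>
         (\<forall>F. finite_dim_subspace scl F \<and> F \<subseteq> Z \<longrightarrow>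
           (\<exists>j. \<forall>v\<in>F. \<forall>z \<in> closed_span scl ((u \<circ> i) ` {k. k > j}).
              norm v \<le> (M + \<epsilon>) * norm (v + z)))))"

definition finite_dim_separation_property ::
  "('k::real_or_complex_field \<Rightarrow> 'x::banach \<Rightarrow> 'x) \<Rightarrow> (nat \<Rightarrow> 'x) \<Rightarrow> bool"
  where "finite_dim_separation_property scl u \<longleftrightarrow> (\<exists>M>0. fds_with scl u M)"

definition finite_dim_separation_constant ::
  "('k::real_or_complex_field \<Rightarrow> 'x::banach \<Rightarrow> 'x) \<Rightarrow> (nat \<Rightarrow> 'x) \<Rightarrow> real"
  where "finite_dim_separation_constant scl u = Inf {M. M > 0 \<and> fds_with scl u M}"

end

theory Submission
  imports Defs "HOL-Complex_Analysis.Great_Picard"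
begin

text \<open>
  Two implications are soft. An almost greedy system is quasi-greedy because the zero projection
  competes in \<^const>\<open>proj_error\<close>. A quasi-greedy system is total because, if all coordinates of \<open>v\<close>
  vanish, a finitely supported \<open>w\<close> near \<open>v\<close> is a greedy approximation of the small vector \<open>w - v\<close>.

  \<^emph>\<open>From Markushevich bases to finite dimensional separation\<close> (\<open>markushevich_basis_imp_fds\<close>).
  Choose countably many norming functionals \<open>F k\<close>, among them multiples of all coordinate functionals,
  and let \<open>J\<close> be the isometric embedding \<open>v \<mapsto> (F k v)\<^sub>k\<close> into the bounded scalar sequences. A
  subsequence of the normalised basis vectors converges under each \<open>F k\<close>, with limits forming a
  bounded sequence \<open>\<Phi>\<close>, which replaces a weak* cluster point in the bidual. If \<open>\<Phi> = J y\<close>, then all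
  coordinates of \<open>y\<close> vanish and totality gives \<open>\<Phi> = 0\<close>; otherwise \<open>\<Phi>\<close> has positive distance from the
  closed subspace \<open>range J\<close>. In both cases some constant \<open>C\<close> satisfies
  \<open>norm v \<le> C * norm (J v + c \<Phi>)\<close> for all \<open>v\<close> and \<open>c\<close>. The images of the normalised basis vectors, shifted
  by \<open>- \<Phi>\<close>, tend to zero in each entry and are bounded away from zero in norm. Mazur's
  selection therefore yields a subsequence that is almost orthogonal, up to \<open>1 + \<epsilon>\<close>, to \<open>\<Phi>\<close> and its own
  initial segments, and whose tails are almost orthogonal to any given finite-dimensional subspace
  (\<open>almost_orthogonal_subsequence\<close>, \<open>tail_almost_orthogonal\<close>). Undoing the shift costs the factor \<open>C\<close>;
  Grunblum's criterion then gives basic subsequences of constant at most \<open>C + \<epsilon>\<close>.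

  \<^emph>\<open>From separation to almost greediness, with constants.\<close> Let \<open>M\<close> exceed the separation constant
  and let \<open>D\<close> be a finite block far out in the separated subsequence. A weak thresholding set for a
  vector that is large enough on \<open>D\<close>, and nowhere else, can only be \<open>D\<close>; so the best approximation
  property compares what lies off \<open>D\<close> with the block on \<open>D\<close>, and separation removes the correction
  supported on \<open>D\<close>. If instead the vector is small on \<open>D\<close>, the weak thresholding set avoids \<open>D\<close>, which
  bounds the block by the vector. Composing the two comparisons gives hyperdemocracy
  (\<open>hyperdemocratic_bound\<close>) and a bound on all greedy remainders (\<open>greedy_remainder_bound\<close>). The latter
  needs coordinates tending to zero; for finitely supported vectors this is automatic, and the bound
  for them makes the coordinate functionals bounded, after which it applies to every vector.
  Quasi-greediness and hyperdemocracy together give almost greediness in the usual way. The constants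
  are obtained for every \<open>M\<close> above the separation constant, hence in the limit.
\<close>


section \<open>Scalars and finite-dimensional subspaces\<close>

lemma scalar_embedding:
  obtains \<phi> :: "'k::real_or_complex_field \<Rightarrow> complex"
  where "\<And>a b. \<phi> (a + b) = \<phi> a + \<phi> b" "\<And>a b. \<phi> (a - b) = \<phi> a - \<phi> b"
    "\<And>a b. \<phi> (a * b) = \<phi> a * \<phi> b" "\<And>r. \<phi> (of_real r) = of_real r"
    "\<And>a. norm (\<phi> a) = norm a" "inj \<phi>" "range \<phi> = \<real> \<or> range \<phi> = UNIV"
proof -
  obtain \<phi> :: "'k \<Rightarrow> complex" where p: "\<phi> 1 = 1" "\<And>a b. \<phi> (a + b) = \<phi> a + \<phi> b"
      "\<And>a b. \<phi> (a * b) = \<phi> a * \<phi> b" "\<And>r a. \<phi> (r *\<^sub>R a) = r *\<^sub>R \<phi> a"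
      "\<And>a. norm (\<phi> a) = norm a" "range \<phi> = \<real> \<or> range \<phi> = UNIV"
    using real_or_complex[where 'a = 'k] by blast
  have diff: "\<phi> (a - b) = \<phi> a - \<phi> b" for a b
    using p(2)[of "a - b" b] by simp
  moreover have "\<phi> (of_real r) = of_real r" for r
    by (simp add: of_real_def p(4) p(1))
  moreover have "inj \<phi>"
  proof (rule injI)
    fix a b assume "\<phi> a = \<phi> b"
    then have "norm (a - b) = 0" by (metis diff p(5) right_minus_eq norm_zero)
    then show "a = b" by simp
  qed
  ultimately show thesis using that p by blast
qed

lemma scalar_bounded_convergent_subsequence:
  fixes a :: "nat \<Rightarrow> 'k::real_or_complex_field"
  assumes "bounded (range a)"
  obtains l r where "strict_mono (r :: nat \<Rightarrow> nat)" "(a \<circ> r) \<longlonglongrightarrow> l"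
proof -
  obtain \<phi> :: "'k \<Rightarrow> complex" where p: "\<And>a b. \<phi> (a - b) = \<phi> a - \<phi> b"
      "\<And>a. norm (\<phi> a) = norm a" "range \<phi> = \<real> \<or> range \<phi> = UNIV"
    by (rule scalar_embedding) blast
  have "bounded (range (\<phi> \<circ> a))"
    using assms by (auto simp: bounded_iff p(2))
  then obtain l r where r: "strict_mono (r :: nat \<Rightarrow> nat)" "((\<phi> \<circ> a) \<circ> r) \<longlonglongrightarrow> l"
    using bounded_imp_convergent_subsequence by blast
  have "closed (range \<phi>)"
    using p(3) closed_complex_Reals by auto
  moreover have "\<And>n. ((\<phi> \<circ> a) \<circ> r) n \<in> range \<phi>" by simp
  ultimately have "l \<in> range \<phi>"
    using r(2) closed_sequentially by blast
  then obtain b where b: "l = \<phi> b" by blast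
  have "(a \<circ> r) \<longlonglongrightarrow> b"
    using r(2) unfolding b tendsto_iff dist_norm comp_def by (simp only: p(1,2) flip: p(1))
  then show thesis using r(1) that by blast
qed

lemma scalar_countable_dense:
  obtains Q :: "'k::real_or_complex_field set"
  where "countable Q" "\<And>a e. 0 < e \<Longrightarrow> \<exists>q\<in>Q. norm (a - q) < e"
proof -
  obtain \<phi> :: "'k \<Rightarrow> complex" where p: "\<And>a b. \<phi> (a - b) = \<phi> a - \<phi> b"
      "\<And>a. norm (\<phi> a) = norm a" "inj \<phi>"
    by (rule scalar_embedding) blast
  obtain T where T: "countable T" "T \<subseteq> range \<phi>" "range \<phi> \<subseteq> closure T"
    using separable[of "range \<phi>"] by blast
  show thesis
  proof
    show "countable (\<phi> -` T)"
      using T(1) p(3) by (meson countable_image_inj_on countable_subset image_vimage_subset inj_on_subset subset_UNIV)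
    fix a :: 'k and e :: real assume "0 < e"
    moreover have "\<phi> a \<in> closure T" using T(3) by auto
    ultimately obtain t where "t \<in> T" "dist t (\<phi> a) < e"
      unfolding closure_approachable by blast
    moreover then obtain q where "t = \<phi> q" using T(2) by blast
    ultimately show "\<exists>q\<in>\<phi> -` T. norm (a - q) < e"
      by (metis dist_norm norm_minus_commute p(1,2) vimageI2)
  qed
qed

locale normed_space_over = vector_space scl
  for scl :: "'k::real_or_complex_field \<Rightarrow> 'x::real_normed_vector \<Rightarrow> 'x" +
  assumes norm_scl: "norm (scl c v) = norm c * norm v"

sublocale banach_space_over \<subseteq> normed_space_over scl
  by unfold_locales (rule norm_scl)

context normed_space_over
begin

lemma tendsto_scl:
  assumes "(a \<longlongrightarrow> c) F" "(v \<longlongrightarrow> w) F"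
  shows "((\<lambda>n. scl (a n) (v n)) \<longlongrightarrow> scl c w) F"
proof -
  have lim: "((\<lambda>n. norm (a n - c) * norm (v n) + norm c * norm (v n - w)) \<longlongrightarrow> 0 * norm w + norm c * 0) F"
    using assms by (intro tendsto_intros tendsto_norm_zero LIM_zero)
  have "norm (scl (a n) (v n) - scl c w)
      \<le> norm (a n - c) * norm (v n) + norm c * norm (v n - w)" for n
  proof -
    have "scl (a n) (v n) - scl c w = scl (a n - c) (v n) + scl c (v n - w)"
      by (simp add: scale_left_diff_distrib scale_right_diff_distrib)
    then show ?thesis by (metis norm_scl norm_triangle_ineq)
  qed
  then have "\<forall>\<^sub>F n in F. norm (scl (a n) (v n) - scl c w) \<le> norm (a n - c) * norm (v n) + norm c * norm (v n - w)"
    by (intro always_eventually allI)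
  moreover have "((\<lambda>n. norm (a n - c) * norm (v n) + norm c * norm (v n - w)) \<longlongrightarrow> 0) F"
    using lim by simp
  ultimately have "((\<lambda>n. scl (a n) (v n) - scl c w) \<longlongrightarrow> 0) F"
    by (rule Lim_null_comparison)
  then show ?thesis by (rule LIM_zero_cancel)
qed

lemma closed_subspace_separated:
  assumes "subspace S" "closed S" "b \<notin> S"
  obtains d where "d > 0" "\<And>f c. f \<in> S \<Longrightarrow> norm c * d \<le> norm (f + scl c b)"
proof
  have "S \<noteq> {}" using assms(1) subspace_0 by blast
  then show "infdist b S > 0"
    using assms infdist_pos_not_in_closed by blast
  fix f c assume f: "f \<in> S"
  show "norm c * infdist b S \<le> norm (f + scl c b)"
  proof (cases "c = 0")
    case False
    have "scl (- (1 / c)) f \<in> S" using assms(1) f subspace_scale by blast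
    then have "infdist b S \<le> norm (b - scl (- (1 / c)) f)"
      by (metis infdist_le dist_norm)
    then have "norm c * infdist b S \<le> norm (scl c (b - scl (- (1 / c)) f))"
      by (simp add: norm_scl mult_left_mono)
    also have "scl c (b - scl (- (1 / c)) f) = f + scl c b"
      using False by (simp add: scale_right_distrib)
    finally show ?thesis .
  qed simp
qed

text \<open>Induction on the spanning set: a new vector outside the old span has positive distance to it,
  which bounds its coefficients along a bounded sequence.\<close>

lemma finite_span_bounded_convergent_subsequence:
  assumes "finite B" "range s \<subseteq> span B" "bounded (range s)"
  shows "\<exists>l\<in>span B. \<exists>r::nat \<Rightarrow> nat. strict_mono r \<and> (s \<circ> r) \<longlonglongrightarrow> l"
  using assms
proof (induction B arbitrary: s rule: finite_induct)
  case empty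
  then have "s = (\<lambda>n. 0)" by (auto simp: fun_eq_iff)
  then show ?case by (auto simp: comp_def intro!: exI[of _ id] strict_mono_id)
next
  case (insert b B)
  show ?case
  proof (cases "b \<in> span B")
    case True
    then show ?thesis using insert by (simp add: span_redundant)
  next
    case False
    have "closed (span B)"
    proof (unfold closed_sequential_limits, intro allI impI, elim conjE)
      fix t l assume t: "\<forall>n. t n \<in> span B" "t \<longlonglongrightarrow> l"
      then have "bounded (range t)" by (simp add: convergent_imp_bounded)
      then obtain l' r where r: "l' \<in> span B" "strict_mono (r :: nat \<Rightarrow> nat)" "(t \<circ> r) \<longlonglongrightarrow> l'"
        using insert.IH[of t] t(1) by blast
      then have "l' = l" using LIMSEQ_subseq_LIMSEQ[OF t(2) r(2)] LIMSEQ_unique by blast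
      then show "l \<in> span B" using r(1) by simp
    qed
    then obtain d where d: "d > 0" "\<And>f c. f \<in> span B \<Longrightarrow> norm c * d \<le> norm (f + scl c b)"
      using closed_subspace_separated[OF subspace_span _ False] by blast
    have "\<forall>n. \<exists>c. s n - scl c b \<in> span B"
      using insert.prems(1) span_breakdown_eq by blast
    then obtain c where c: "\<And>n. s n - scl (c n) b \<in> span B" by metis
    obtain R where R: "\<And>n. norm (s n) \<le> R"
      using insert.prems(2) by (auto simp: bounded_iff)
    have cR: "norm (c n) \<le> R / d" for n
      using d(2)[OF c[of n], of "c n"] R[of n] d(1) by (simp add: pos_le_divide_eq)
    then have "bounded (range c)" by (auto simp: bounded_iff)
    then obtain a r where r: "strict_mono (r :: nat \<Rightarrow> nat)" "(c \<circ> r) \<longlonglongrightarrow> a"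
      by (rule scalar_bounded_convergent_subsequence)
    define t where "t n = s (r n) - scl (c (r n)) b" for n
    have "norm (t n) \<le> R + R / d * norm b" for n
    proof -
      have "norm (t n) \<le> norm (s (r n)) + norm (c (r n)) * norm b"
        unfolding t_def by (metis norm_triangle_ineq4 norm_scl)
      then show ?thesis using R[of "r n"] mult_right_mono[OF cR[of "r n"], of "norm b"] by simp
    qed
    then have "bounded (range t)" by (auto simp: bounded_iff)
    moreover have "range t \<subseteq> span B" using c by (auto simp: t_def)
    ultimately obtain l r' where l: "l \<in> span B" "strict_mono (r' :: nat \<Rightarrow> nat)" "(t \<circ> r') \<longlonglongrightarrow> l"
      using insert.IH by blast
    have "(\<lambda>n. scl (c (r (r' n))) b) \<longlonglongrightarrow> scl a b"
      using LIMSEQ_subseq_LIMSEQ[OF r(2) l(2)] by (auto intro!: tendsto_scl simp: comp_def)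
    then have "(\<lambda>n. (t \<circ> r') n + scl (c (r (r' n))) b) \<longlonglongrightarrow> l + scl a b"
      using l(3) tendsto_add by blast
    then have "(s \<circ> (r \<circ> r')) \<longlonglongrightarrow> l + scl a b"
      by (simp add: t_def comp_def)
    moreover have "l + scl a b \<in> span (insert b B)"
      using l(1) by (meson insertI1 span_add span_base span_mono span_scale subset_insertI subsetD)
    moreover have "strict_mono (r \<circ> r')" using r(1) l(2) strict_mono_o by blast
    ultimately show ?thesis by blast
  qed
qed

lemma span_image_sum:
  fixes f :: "nat \<Rightarrow> 'x"
  assumes "v \<in> span (f ` S)"
  obtains a n where "v = (\<Sum>k<n. scl (a k) (f k))" "\<And>k. k \<notin> S \<Longrightarrow> a k = 0"
proof -
  have "\<exists>a n. v = (\<Sum>k<n. scl (a k) (f k)) \<and> (\<forall>k. k \<notin> S \<longrightarrow> a k = 0)"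
    using assms
  proof (induction rule: span_induct_alt)
    case base
    show ?case by (rule exI[of _ "\<lambda>k. 0"]) auto
  next
    case (step c y z)
    then obtain j a n where j: "y = f j" "j \<in> S" "z = (\<Sum>k<n. scl (a k) (f k))"
      "\<forall>k. k \<notin> S \<longrightarrow> a k = 0" by blast
    let ?a = "\<lambda>k. (if k < n then a k else 0)"
    let ?b = "\<lambda>k. (if k = j then c else 0)"
    let ?m = "max n (Suc j)"
    have "z = (\<Sum>k<?m. scl (?a k) (f k))"
      unfolding j(3) by (rule sum.mono_neutral_cong_left) auto
    moreover have "scl c y = (\<Sum>k<?m. scl (?b k) (f k))"
      by (subst sum.mono_neutral_right[of _ "{j}"]) (auto simp: j(1))
    ultimately have "scl c y + z = (\<Sum>k<?m. scl (?b k + ?a k) (f k))"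
      by (simp add: scale_left_distrib sum.distrib)
    moreover have "\<forall>k. k \<notin> S \<longrightarrow> ?b k + ?a k = 0" using j by auto
    ultimately show ?case by (intro exI[of _ "\<lambda>k. ?b k + ?a k"] exI[of _ ?m]) auto
  qed
  then show thesis using that by blast
qed

end


section \<open>Norming functionals\<close>

definition sublinear :: "('a::real_vector \<Rightarrow> real) \<Rightarrow> bool"
  where "sublinear p \<longleftrightarrow>
    (\<forall>u v. p (u + v) \<le> p u + p v) \<and> (\<forall>t u. 0 \<le> t \<longrightarrow> p (t *\<^sub>R u) = t * p u)"

lemma sublinearD:
  assumes "sublinear p"
  shows "p (u + v) \<le> p u + p v" "0 \<le> t \<Longrightarrow> p (t *\<^sub>R u) = t * p u" "p 0 = 0" "- p (- u) \<le> p u"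
proof -
  show 1: "p (u + v) \<le> p u + p v" for u v
    using assms by (simp add: sublinear_def)
  show 2: "0 \<le> t \<Longrightarrow> p (t *\<^sub>R u) = t * p u" for t u
    using assms by (simp add: sublinear_def)
  show 3: "p 0 = 0" using 2[of 0 0] by simp
  show "- p (- u) \<le> p u" using 1[of u "- u"] 3 by simp
qed

text \<open>The witness is \<open>u \<mapsto> INF t\<ge>0. p (u + t y) - t p y\<close>; taking \<open>t = 1\<close> at \<open>- y\<close> gives the last property. It
  serves twice: a minimal sublinear functional coincides with its witness and hence is odd, and for the norm
  the witness forces the final functional to attain the norm at \<open>y\<close>.\<close>

lemma sublinear_below_in_direction:
  assumes p: "sublinear p"
  obtains q where "sublinear q" "\<And>u. q u \<le> p u" "q (- y) \<le> - p y"
proof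
  let ?S = "\<lambda>u. (\<lambda>t. p (u + t *\<^sub>R y) - t * p y) ` {0..}"
  define q where "q u = Inf (?S u)" for u
  note D = sublinearD[OF p]
  have low: "- p (- u) \<le> p (u + t *\<^sub>R y) - t * p y" if "0 \<le> t" for u t
    using D(1)[of "u + t *\<^sub>R y" "- u"] D(2)[OF that, of y] by simp
  have bdd: "bdd_below (?S u)" for u
    using low by (intro bdd_belowI[of _ "- p (- u)"]) auto
  have le: "q u \<le> p (u + t *\<^sub>R y) - t * p y" if "0 \<le> t" for u t
    unfolding q_def using bdd that by (intro cInf_lower) auto
  have ge: "c \<le> q u" if "\<And>t. 0 \<le> t \<Longrightarrow> c \<le> p (u + t *\<^sub>R y) - t * p y" for c u
    unfolding q_def using that by (intro cInf_greatest) auto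
  show "q u \<le> p u" for u using le[of 0 u] by simp
  show "q (- y) \<le> - p y" using le[of 1 "- y"] D(3) by simp
  have add: "q (u + v) \<le> q u + q v" for u v
  proof -
    have "q (u + v) - (p (v + s *\<^sub>R y) - s * p y) \<le> q u" if s: "0 \<le> s" for s
    proof (rule ge)
      fix t :: real assume t: "0 \<le> t"
      have "q (u + v) \<le> p ((u + v) + (t + s) *\<^sub>R y) - (t + s) * p y"
        using s t by (intro le) simp
      also have "(u + v) + (t + s) *\<^sub>R y = (u + t *\<^sub>R y) + (v + s *\<^sub>R y)"
        by (simp add: scaleR_left_distrib)
      also have "p \<dots> \<le> p (u + t *\<^sub>R y) + p (v + s *\<^sub>R y)" by (rule D(1))
      finally show "q (u + v) - (p (v + s *\<^sub>R y) - s * p y) \<le> p (u + t *\<^sub>R y) - t * p y"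
        by (simp add: algebra_simps)
    qed
    then have "q (u + v) - q u \<le> q v"
      by (intro ge) (simp add: algebra_simps)
    then show ?thesis by simp
  qed
  have hom_le: "c * q u \<le> q (c *\<^sub>R u)" if c: "0 < c" for c u
  proof (rule ge)
    fix t :: real assume t: "0 \<le> t"
    have "c * q u \<le> c * (p (u + (t / c) *\<^sub>R y) - t / c * p y)"
      using c t by (intro mult_left_mono le) auto
    also have "\<dots> = p (c *\<^sub>R (u + (t / c) *\<^sub>R y)) - t * p y"
      using c by (simp add: D(2) right_diff_distrib)
    also have "c *\<^sub>R (u + (t / c) *\<^sub>R y) = c *\<^sub>R u + t *\<^sub>R y"
      using c by (simp add: scaleR_right_distrib)
    finally show "c * q u \<le> p (c *\<^sub>R u + t *\<^sub>R y) - t * p y" .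
  qed
  have "q 0 = 0"
    using le[of 0 0] ge[of 0 0] D(2)[of _ y] D(3) by (auto intro: antisym)
  moreover have "q (c *\<^sub>R u) = c * q u" if c: "0 < c" for c u
  proof (rule antisym)
    have "(1 / c) * q (c *\<^sub>R u) \<le> q u"
      using hom_le[of "1 / c" "c *\<^sub>R u"] c by simp
    then show "q (c *\<^sub>R u) \<le> c * q u" using c by (simp add: field_simps)
  qed (rule hom_le[OF c])
  ultimately show "sublinear q"
    unfolding sublinear_def using add by (metis mult_zero_left order_le_less scaleR_zero_left)
qed

text \<open>Zorn's lemma applies because the pointwise infimum of a chain is again sublinear, the values at \<open>u\<close>
  being bounded below by \<open>- p (- u)\<close>.\<close>

lemma minimal_sublinear:
  assumes p: "sublinear p"
  obtains m where "sublinear m" "\<And>u. m u \<le> p u"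
    "\<And>q. sublinear q \<Longrightarrow> (\<And>u. q u \<le> m u) \<Longrightarrow> q = m"
proof -
  define A where "A = {q. sublinear q \<and> (\<forall>u. q u \<le> p u)}"
  define P where "P = (\<lambda>q r :: 'a \<Rightarrow> real. \<forall>u. r u \<le> q u)"
  have po: "partial_order_on A (relation_of P A)"
    by (rule partial_order_on_relation_ofI) (auto simp: P_def fun_eq_iff intro: order_trans antisym)
  have "\<exists>u\<in>A. \<forall>a\<in>C. P a u" if C: "C \<in> Chains (relation_of P A)" for C
  proof (cases "C = {}")
    case True
    then show ?thesis using p by (auto simp: A_def)
  next
    case False
    have CA: "C \<subseteq> A" and ch: "\<And>q r. q \<in> C \<Longrightarrow> r \<in> C \<Longrightarrow> P q r \<or> P r q"
      using C by (auto simp: Chains_def relation_of_def)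
    define m where "m u = Inf ((\<lambda>q. q u) ` C)" for u
    have bdd: "bdd_below ((\<lambda>q. q u) ` C)" for u
    proof (rule bdd_belowI[of _ "- p (- u)"])
      fix t assume "t \<in> (\<lambda>q. q u) ` C"
      then obtain q where q: "q \<in> A" "t = q u" using CA by auto
      then show "- p (- u) \<le> t"
        using sublinearD(4)[of q u] by (auto simp: A_def intro: order_trans[rotated])
    qed
    have le: "m u \<le> q u" if "q \<in> C" for q u
      unfolding m_def using bdd that by (intro cInf_lower) auto
    have ge: "c \<le> m u" if "\<And>q. q \<in> C \<Longrightarrow> c \<le> q u" for c u
      unfolding m_def using that False by (intro cInf_greatest) auto
    have sub: "sublinear q" "\<And>u. q u \<le> p u" if "q \<in> C" for q
      using that CA by (auto simp: A_def)
    have "m (u + v) \<le> m u + m v" for u v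
    proof -
      have *: "m (u + v) \<le> q u + r v" if qr: "q \<in> C" "r \<in> C" for q r
      proof -
        obtain s where s: "s \<in> C" "s u \<le> q u" "s v \<le> r v"
          using ch[OF qr] qr unfolding P_def by blast
        then show ?thesis
          using le[OF s(1), of "u + v"] sublinearD(1)[OF sub(1)[OF s(1)], of u v] by linarith
      qed
      have "m (u + v) - r v \<le> m u" if "r \<in> C" for r
        by (rule ge) (use * that in \<open>simp add: algebra_simps\<close>)
      then have "m (u + v) - m u \<le> m v"
        by (intro ge) (simp add: algebra_simps)
      then show ?thesis by simp
    qed
    moreover have "m (t *\<^sub>R u) = t * m u" if t: "0 \<le> t" for t u
    proof (cases "t = 0")
      case True
      have "(\<lambda>q. q 0) ` C = {0}"
        using False sub(1) sublinearD(3) by force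
      then show ?thesis using True by (simp add: m_def)
    next
      case False
      with t have t: "0 < t" by simp
      have "m (t *\<^sub>R u) \<le> t * q u" if "q \<in> C" for q
        using le[OF that, of "t *\<^sub>R u"] sublinearD(2)[OF sub(1)[OF that]] t by simp
      then have "m (t *\<^sub>R u) / t \<le> m u"
        using t by (intro ge) (simp add: field_simps)
      moreover have "t * m u \<le> m (t *\<^sub>R u)"
      proof (rule ge)
        fix q assume q: "q \<in> C"
        show "t * m u \<le> q (t *\<^sub>R u)"
          using le[OF q, of u] sublinearD(2)[OF sub(1)[OF q]] t by simp
      qed
      ultimately show ?thesis using t by (simp add: field_simps)
    qed
    ultimately have "sublinear m" by (auto simp: sublinear_def)
    moreover have "m u \<le> p u" for u
      using False le sub(2) by (meson all_not_in_conv order_trans)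
    ultimately have "m \<in> A" by (simp add: A_def)
    then show ?thesis using le by (auto simp: P_def)
  qed
  from predicate_Zorn[OF po this] obtain m where m: "m \<in> A" "\<And>q. q \<in> A \<Longrightarrow> P m q \<Longrightarrow> q = m"
    by blast
  show thesis
  proof (rule that[of m])
    show "sublinear m" "\<And>u. m u \<le> p u" using m(1) by (auto simp: A_def)
    then show "q = m" if "sublinear q" "\<And>u. q u \<le> m u" for q
      using m(2)[of q] that by (auto simp: A_def P_def intro: order_trans)
  qed
qed

text \<open>A minimal sublinear functional is odd, hence linear.\<close>

lemma norming_real_functional:
  fixes y :: "'a::real_normed_vector"
  obtains f :: "'a \<Rightarrow> real" where "linear f" "\<And>u. f u \<le> norm u" "f y = norm y"
proof -
  have "sublinear (norm :: 'a \<Rightarrow> real)"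
    by (auto simp: sublinear_def norm_triangle_ineq)
  then obtain p where p: "sublinear p" "\<And>u. p u \<le> norm u" "p (- y) \<le> - norm y"
    using sublinear_below_in_direction[of norm y] by blast
  obtain f where f: "sublinear f" "\<And>u. f u \<le> p u"
    "\<And>q. sublinear q \<Longrightarrow> (\<And>u. q u \<le> f u) \<Longrightarrow> q = f"
    using minimal_sublinear[OF p(1)] by blast
  note D = sublinearD[OF f(1)]
  have neg: "f (- u) = - f u" for u
  proof -
    obtain q where "sublinear q" "\<And>u. q u \<le> f u" "q (- u) \<le> - f u"
      using sublinear_below_in_direction[OF f(1)] by blast
    then have "f (- u) \<le> - f u" using f(3) by metis
    then show ?thesis using D(4)[of u] by simp
  qed
  have "f (u + v) = f u + f v" for u v
    using D(1)[of u v] D(1)[of "- u" "- v"] neg[of u] neg[of v] neg[of "u + v"] by simp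
  moreover have "f (c *\<^sub>R u) = c * f u" for c u
  proof (cases "0 \<le> c")
    case False
    then have "f (- (c *\<^sub>R u)) = - c * f u"
      using D(2)[of "- c" u] by simp
    then show ?thesis using neg by simp
  qed (rule D(2))
  ultimately have "linear f" by (intro linearI) auto
  moreover have "f u \<le> norm u" for u using f(2) p(2) order_trans by blast
  moreover from this[of y] have "f y = norm y"
    using f(2)[of "- y"] p(3) neg[of y] by simp
  ultimately show thesis by (rule that)
qed

text \<open>Over \<open>\<complex>\<close> the real functional \<open>f\<close> becomes \<open>v \<mapsto> f v - \<i> f (\<i> v)\<close>; multiplying \<open>v\<close> by a scalar
  of modulus 1 that makes the value real shows that the norm does not grow.\<close>

lemma (in banach_space_over) norming_functional:
  fixes y :: 'x
  shows "\<exists>g :: 'x \<Rightarrow> 'k. (\<forall>u v. g (u + v) = g u + g v) \<and> (\<forall>c u. g (scl c u) = c * g u) \<and>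
    (\<forall>u. norm (g u) \<le> norm u) \<and> norm (g y) = norm y"
proof -
  obtain f :: "'x \<Rightarrow> real" where f: "linear f" "\<And>u. f u \<le> norm u" "f y = norm y"
    using norming_real_functional[of y] by blast
  obtain \<phi> :: "'k \<Rightarrow> complex" where p: "\<And>a b. \<phi> (a + b) = \<phi> a + \<phi> b" "\<And>a b. \<phi> (a - b) = \<phi> a - \<phi> b"
    "\<And>a b. \<phi> (a * b) = \<phi> a * \<phi> b" "\<And>r. \<phi> (of_real r) = of_real r"
    "\<And>a. norm (\<phi> a) = norm a" "inj \<phi>" "range \<phi> = \<real> \<or> range \<phi> = UNIV"
    by (rule scalar_embedding) blast
  have fadd: "f (u + v) = f u + f v" and fscl: "f (scl (of_real r) u) = r * f u" for u v r
    using f(1) by (simp_all add: linear_add linear_cmul scl_of_real)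
  have *: "norm (g u) \<le> norm u" "norm (g y) = norm y"
    if g: "\<And>c u. g (scl c u) = c * g u" "\<And>u. Re (\<phi> (g u)) = f u" for g u
  proof -
    show le: "norm (g u) \<le> norm u" for u
    proof (cases "g u = 0")
      case False
      let ?v = "scl (of_real (norm (g u)) / g u) u"
      have "g ?v = of_real (norm (g u))"
        using False by (simp add: g(1))
      then have "f ?v = norm (g u)"
        using g(2)[of ?v] by (simp add: p(4))
      then show ?thesis
        using f(2)[of ?v] False by (simp add: norm_scl norm_divide)
    qed simp
    have "norm y \<le> norm (g y)"
      using complex_Re_le_cmod[of "\<phi> (g y)"] by (simp add: g(2) f(3) p(5))
    then show "norm (g y) = norm y" using le[of y] by simp
  qed
  from p(7) show ?thesis
  proof
    assume real: "range \<phi> = \<real>"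
    have "of_real (f (scl c u)) = c * of_real (f u)" for c u
    proof -
      have "\<phi> c \<in> \<real>" using real by blast
      then obtain r where "\<phi> c = \<phi> (of_real r)" unfolding p(4) by (rule Reals_cases)
      then have "c = of_real r" by (rule injD[OF p(6)])
      then show ?thesis by (simp add: fscl)
    qed
    moreover have "of_real (f (u + v)) = (of_real (f u) + of_real (f v) :: 'k)" for u v
      by (simp add: fadd)
    moreover have "Re (\<phi> (of_real (f u))) = f u" for u by (simp add: p(4))
    ultimately show ?thesis
      using *[of "\<lambda>u. of_real (f u)"] by (intro exI[of _ "\<lambda>u. of_real (f u)"]) blast
  next
    assume "range \<phi> = UNIV"
    then obtain i where i: "\<phi> i = \<i>" by (metis UNIV_I imageE)
    have ii: "i * i = - 1"
      using p(6) by (rule injD) (use p(2)[of 0 1] p(4)[of 0] p(4)[of 1] in \<open>simp add: p(3) i\<close>)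
    have dec: "\<exists>a b. c = of_real a + i * of_real b" for c
    proof (intro exI)
      show "c = of_real (Re (\<phi> c)) + i * of_real (Im (\<phi> c))"
        using p(6) by (rule injD) (simp add: p(1,3,4) i flip: complex_eq)
    qed
    define g where "g u = of_real (f u) - i * of_real (f (scl i u))" for u
    have gadd: "g (u + v) = g u + g v" for u v
      by (simp add: g_def fadd scale_right_distrib algebra_simps)
    have greal: "g (scl (of_real r) u) = of_real r * g u" for r u
      unfolding g_def scale_left_commute[of i] fscl by (simp add: algebra_simps)
    have "scl i (scl i u) = - u" for u by (simp add: ii)
    moreover have "f (- u) = - f u" for u using f(1) by (simp add: linear_neg)
    ultimately have gi: "g (scl i u) = i * g u" for u
    proof -
      have "i * g u = i * of_real (f u) - (i * i) * of_real (f (scl i u))"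
        by (simp add: g_def algebra_simps)
      then show ?thesis
        using \<open>\<And>u. scl i (scl i u) = - u\<close> \<open>\<And>u. f (- u) = - f u\<close> by (simp add: g_def ii)
    qed
    have "g (scl c u) = c * g u" for c u
    proof -
      obtain a b where c: "c = of_real a + i * of_real b" using dec by blast
      have "scl c u = scl (of_real a) u + scl i (scl (of_real b) u)"
        by (simp add: c scale_left_distrib)
      then show ?thesis by (simp only: gadd gi greal) (simp add: c algebra_simps)
    qed
    moreover have "Re (\<phi> (g u)) = f u" for u by (simp add: g_def p i)
    ultimately show ?thesis using gadd *[of g] by (intro exI[of _ g]) blast
  qed
qed


section \<open>Selecting subsequences that are almost orthogonal to finite-dimensional subspaces\<close>

text \<open>Mazur's argument only sees countably many functionals. This form covers a Banach space with norming
  functionals as well as the bounded scalar sequences, where the functionals are the evaluations.\<close>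

locale norming_sequence = normed_space_over scl
  for scl :: "'k::real_or_complex_field \<Rightarrow> 'x::real_normed_vector \<Rightarrow> 'x" +
  fixes g :: "nat \<Rightarrow> 'x \<Rightarrow> 'k"
  assumes g_add: "g k (u + v) = g k u + g k v"
    and g_scl: "g k (scl c u) = c * g k u"
    and g_le: "norm (g k u) \<le> norm u"
    and g_norming: "t < norm u \<Longrightarrow> \<exists>k. t < norm (g k u)"
begin

lemma g_diff: "g k (u - v) = g k u - g k v"
  using g_add[of k "u - v" v] by simp

lemma g_sum: "g k (\<Sum>i\<in>I. f i) = (\<Sum>i\<in>I. g k (f i))"
proof -
  have "g k 0 = 0" using g_add[of k 0 0] by simp
  then show ?thesis by (induction I rule: infinite_finite_induct) (auto simp: g_add)
qed

text \<open>Compactness of the unit sphere of a finite-dimensional space: otherwise unit vectors \<open>w N\<close> on which the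
  first \<open>N\<close> functionals are at most \<open>1 - e\<close> would subconverge to a unit vector on which all of them are.\<close>

lemma finitely_many_norming:
  assumes "finite B" "0 < e"
  obtains N where "\<And>u. u \<in> span B \<Longrightarrow> \<exists>k\<le>N. (1 - e) * norm u \<le> norm (g k u)"
proof -
  have "\<exists>N. \<forall>u\<in>span B. \<exists>k\<le>N. (1 - e) * norm u \<le> norm (g k u)"
  proof (rule ccontr)
    assume "\<not> ?thesis"
    then have "\<forall>N. \<exists>u\<in>span B. \<forall>k\<le>N. norm (g k u) < (1 - e) * norm u"
      by (meson not_less)
    then obtain u where u: "\<And>N. u N \<in> span B" "\<And>N k. k \<le> N \<Longrightarrow> norm (g k (u N)) < (1 - e) * norm (u N)"
      by metis
    have pos: "norm (u N) > 0" for N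
      using u(2)[of 0 N] norm_ge_zero[of "g 0 (u N)"] by (metis le0 mult_zero_right not_less zero_less_norm_iff norm_zero)
    define w where "w N = scl (of_real (1 / norm (u N))) (u N)" for N
    have w: "norm (w N) = 1" "w N \<in> span B" "k \<le> N \<Longrightarrow> norm (g k (w N)) \<le> 1 - e" for N k
    proof -
      show "norm (w N) = 1" using pos[of N] by (simp add: w_def norm_scl norm_divide)
      show "w N \<in> span B" using u(1) by (simp add: w_def span_scale)
      assume "k \<le> N"
      then show "norm (g k (w N)) \<le> 1 - e"
        using u(2)[of k N] pos[of N] by (simp add: w_def g_scl norm_mult norm_divide field_simps)
    qed
    then obtain l r where l: "strict_mono (r :: nat \<Rightarrow> nat)" "(w \<circ> r) \<longlonglongrightarrow> l"
      using finite_span_bounded_convergent_subsequence[OF assms(1), of w]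
      by (auto simp: bounded_iff)
    have "(\<lambda>n. norm ((w \<circ> r) n)) \<longlonglongrightarrow> norm l" using l(2) by (rule tendsto_norm)
    then have "norm l = 1" using w(1) by (simp add: LIMSEQ_const_iff)
    then obtain k where k: "1 - e < norm (g k l)" using g_norming[of "1 - e" l] assms(2) by auto
    have "norm (g k (w (r n)) - g k l) \<le> norm ((w \<circ> r) n - l)" for n
      using g_le[of k "w (r n) - l"] by (simp add: g_diff)
    then have "(\<lambda>n. g k (w (r n)) - g k l) \<longlonglongrightarrow> 0"
      by (intro Lim_null_comparison[OF always_eventually[OF allI] tendsto_norm_zero[OF LIM_zero[OF l(2)]]])
    then have "(\<lambda>n. g k (w (r n))) \<longlonglongrightarrow> g k l" by (rule LIM_zero_cancel)
    then have "(\<lambda>n. norm (g k (w (r n)))) \<longlonglongrightarrow> norm (g k l)" by (rule tendsto_norm)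
    moreover have "norm (g k (w (r n))) \<le> 1 - e" if "k \<le> n" for n
      by (rule w(3)) (use seq_suble[OF l(1), of n] that in linarith)
    ultimately have "norm (g k l) \<le> 1 - e"
      by (intro LIMSEQ_le_const2) auto
    then show False using k by simp
  qed
  then show thesis using that by blast
qed

text \<open>The core of all the separation estimates: a vector \<open>z\<close> on which finitely many norming functionals
  are small relative to \<open>u\<close> cannot cancel much of \<open>u\<close>.\<close>

lemma almost_orthogonalI:
  assumes "1 < q" and k: "(1 - (1 - 1 / q) / 2) * norm u \<le> norm (g k u)"
    and small: "norm z < 2 * norm u \<Longrightarrow> norm (g k z) \<le> (1 - 1 / q) / 2 * norm u"
  shows "norm u \<le> q * norm (u + z)"
proof (cases "norm z < 2 * norm u")
  case True
  have "norm (g k u) \<le> norm (g k (u + z)) + norm (g k z)"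
    by (metis add_diff_cancel_right' g_diff norm_triangle_ineq4)
  moreover define h where "h = (1 - 1 / q) / 2 * norm u"
  moreover have "norm u - h \<le> norm (g k u)" using k by (simp add: h_def left_diff_distrib)
  ultimately have "norm u - 2 * h \<le> norm (u + z)"
    using small[OF True] g_le[of k "u + z"] by linarith
  moreover have "2 * h = norm u - norm u / q" by (simp add: h_def left_diff_distrib)
  ultimately have "norm u / q \<le> norm (u + z)" by simp
  then show ?thesis using assms(1) by (simp add: field_simps)
next
  case False
  have "norm z \<le> norm (u + z) + norm u"
    by (metis add_diff_cancel_left' norm_triangle_ineq4)
  then have "norm u \<le> norm (u + z)" using False by simp
  also have "\<dots> \<le> q * norm (u + z)"
    using assms(1) by (simp add: mult_le_cancel_right1)
  finally show ?thesis .
qed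

context
  fixes y :: "nat \<Rightarrow> 'x" and d :: real
  assumes d: "0 < d" "\<And>n. d \<le> norm (y n)"
    and null: "\<And>k. (\<lambda>n. g k (y n)) \<longlonglongrightarrow> 0"
begin

text \<open>Multiples of \<open>y n\<close> with norm above \<open>2 * norm u\<close> cannot come close to \<open>- u\<close>; for the others the lower
  bound \<open>d\<close> limits the coefficient, so finitely many functionals hardly see the added term.\<close>

lemma eventually_almost_orthogonal:
  assumes "finite B" "1 < q"
  shows "\<forall>\<^sub>F n in sequentially. \<forall>u\<in>span B. \<forall>a. norm u \<le> q * norm (u + scl a (y n))"
proof -
  define e where "e = (1 - 1 / q) / 2"
  have e: "0 < e" using assms(2) by (simp add: e_def)
  obtain N where N: "\<And>u. u \<in> span B \<Longrightarrow> \<exists>k\<le>N. (1 - e) * norm u \<le> norm (g k u)"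
    using finitely_many_norming[OF assms(1) e] by blast
  have "\<forall>\<^sub>F n in sequentially. norm (g k (y n)) < e * d / 2" for k
    using tendstoD[OF null[of k], of "e * d / 2"] e d(1) by simp
  then have "\<forall>\<^sub>F n in sequentially. \<forall>k\<in>{..N}. norm (g k (y n)) < e * d / 2"
    by (intro eventually_ball_finite) auto
  then show ?thesis
  proof (rule eventually_mono, intro ballI allI)
    fix n u a assume n: "\<forall>k\<in>{..N}. norm (g k (y n)) < e * d / 2" and "u \<in> span B"
    then obtain k where k: "k \<le> N" "(1 - e) * norm u \<le> norm (g k u)" using N by blast
    show "norm u \<le> q * norm (u + scl a (y n))"
    proof (rule almost_orthogonalI[OF assms(2)])
      show "(1 - (1 - 1 / q) / 2) * norm u \<le> norm (g k u)" using k(2) by (simp add: e_def)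
      assume "norm (scl a (y n)) < 2 * norm u"
      moreover have "norm a * d \<le> norm (scl a (y n))"
        by (simp add: norm_scl d(2) mult_left_mono)
      ultimately have "norm a * d \<le> 2 * norm u" by simp
      have "norm (g k (scl a (y n))) \<le> norm a * (e * d / 2)"
        unfolding g_scl norm_mult using n k(1) by (intro mult_left_mono) (auto intro: less_imp_le)
      also have "\<dots> \<le> e * norm u"
        using mult_left_mono[OF \<open>norm a * d \<le> 2 * norm u\<close>, of "e / 2"] e by (simp add: algebra_simps)
      finally show "norm (g k (scl a (y n))) \<le> (1 - 1 / q) / 2 * norm u" by (simp add: e_def)
    qed
  qed
qed

text \<open>Besides being almost orthogonal to its initial segments and to \<open>B\<close>, the subsequence is chosen with
  geometric decay of the values of more and more functionals, which is what makes it work for other finite-dimensional subspaces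
  in \<open>tail_almost_orthogonal\<close>.\<close>

lemma almost_orthogonal_subsequence:
  assumes "finite B" "0 < e"
  obtains r where "strict_mono r"
    "\<And>k i. i \<le> k \<Longrightarrow> norm (g i (y (r k))) \<le> (1 / 2) ^ k"
    "\<And>k u z. u \<in> span (B \<union> (y \<circ> r) ` {..<k}) \<Longrightarrow> z \<in> span ((y \<circ> r) ` {k..}) \<Longrightarrow>
       norm u \<le> (1 + e) * norm (u + z)"
proof -
  \<comment> \<open>The quotients \<open>c (Suc k) / c k > 1\<close> are the separation constants of the single steps; their
    product telescopes and stays below \<open>1 + e\<close>.\<close>
  define c :: "nat \<Rightarrow> real" where "c k = 1 + e * (1 - (1 / 2) ^ k)" for k
  have c: "1 \<le> c k" "c k < 1 + e" "c k < c (Suc k)" for k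
    using assms(2) by (auto simp: c_def power_le_one)
  define P where "P k m n \<longleftrightarrow> (\<forall>i\<le>k. norm (g i (y n)) \<le> (1 / 2) ^ k) \<and>
    (\<forall>u\<in>span (B \<union> y ` {..<m}). \<forall>a. norm u \<le> c (Suc k) / c k * norm (u + scl a (y n)))" for k m n
  have ev: "\<forall>\<^sub>F n in sequentially. P k m n" for k m
    unfolding P_def
  proof (intro eventually_conj eventually_almost_orthogonal)
    have "\<forall>\<^sub>F n in sequentially. norm (g i (y n)) \<le> (1 / 2) ^ k" for i
      using tendstoD[OF null[of i], of "(1 / 2) ^ k"] by (auto elim: eventually_mono)
    then have "\<forall>\<^sub>F n in sequentially. \<forall>i\<in>{..k}. norm (g i (y n)) \<le> (1 / 2) ^ k"
      by (intro eventually_ball_finite) auto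
    then show "\<forall>\<^sub>F n in sequentially. \<forall>i\<le>k. norm (g i (y n)) \<le> (1 / 2) ^ k"
      by (rule eventually_mono) auto
    show "1 < c (Suc k) / c k" using c(1)[of k] c(3)[of k] by simp
  qed (use assms(1) in simp)
  have "\<exists>r. \<forall>k. (k = 0 \<longrightarrow> P 0 0 (r k)) \<and> (r k < r (Suc k) \<and> P (Suc k) (Suc (r k)) (r (Suc k)))"
  proof (rule dependent_nat_choice)
    show "\<exists>n. (0::nat) = 0 \<longrightarrow> P 0 0 n"
      using eventually_happens[OF ev[of 0 0]] by simp
    show "\<exists>n'. (Suc k = 0 \<longrightarrow> P 0 0 n') \<and> n < n' \<and> P (Suc k) (Suc n) n'" for n k
      using eventually_happens[OF eventually_conj[OF eventually_gt_at_top[of n] ev[of "Suc k" "Suc n"]]]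
      by simp
  qed
  then obtain r where r0: "P 0 0 (r 0)" and r: "\<And>k. r k < r (Suc k)" "\<And>k. P (Suc k) (Suc (r k)) (r (Suc k))"
    by blast
  have mono: "strict_mono r" using r(1) by (simp add: strict_mono_Suc_iff)
  have rP: "\<exists>m. P k m (r k) \<and> r ` {..<k} \<subseteq> {..<m}" for k
  proof (cases k)
    case (Suc j)
    have "r ` {..<k} \<subseteq> {..<Suc (r j)}"
      using mono Suc by (auto simp: less_Suc_eq_le strict_mono_less_eq)
    then show ?thesis using r(2)[of j] Suc by blast
  qed (use r0 in auto)
  have one: "norm u \<le> c (Suc k) / c k * norm (u + scl a (y (r k)))"
    if u: "u \<in> span (B \<union> (y \<circ> r) ` {..<k})" for u k a
  proof -
    obtain m where m: "P k m (r k)" "r ` {..<k} \<subseteq> {..<m}" using rP by blast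
    have "u \<in> span (B \<union> y ` {..<m})"
      by (rule subsetD[OF span_mono u]) (use m(2) in \<open>auto simp: image_comp[symmetric]\<close>)
    then show ?thesis using m(1) by (simp add: P_def)
  qed
  have tele: "norm u \<le> c n / c k * norm (u + (\<Sum>i\<in>{k..<n}. scl (a i) (y (r i))))"
    if "u \<in> span (B \<union> (y \<circ> r) ` {..<k})" "k \<le> n" for u k n a
    using that(2)
  proof (induction n rule: dec_induct)
    case base
    then show ?case using c(1)[of k] by simp
  next
    case (step n)
    let ?v = "u + (\<Sum>i\<in>{k..<n}. scl (a i) (y (r i)))"
    have "?v \<in> span (B \<union> (y \<circ> r) ` {..<n})"
    proof (rule span_add)
      show "u \<in> span (B \<union> (y \<circ> r) ` {..<n})"
        by (rule subsetD[OF span_mono that(1)]) (use step.hyps in auto)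
      show "(\<Sum>i\<in>{k..<n}. scl (a i) (y (r i))) \<in> span (B \<union> (y \<circ> r) ` {..<n})"
        by (intro span_sum span_scale span_base) auto
    qed
    then have "norm ?v \<le> c (Suc n) / c n * norm (?v + scl (a n) (y (r n)))"
      by (rule one)
    then have "c n / c k * norm ?v \<le> c n / c k * (c (Suc n) / c n * norm (?v + scl (a n) (y (r n))))"
      using c(1)[of n] c(1)[of k] by (intro mult_left_mono) auto
    also have "\<dots> = c (Suc n) / c k * norm (u + (\<Sum>i\<in>{k..<Suc n}. scl (a i) (y (r i))))"
      using c(1)[of n] step.hyps by (simp add: add.assoc)
    finally show ?case using step.IH by simp
  qed
  show thesis
  proof (rule that[OF mono])
    show "norm (g i (y (r k))) \<le> (1 / 2) ^ k" if "i \<le> k" for i k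
      using rP[of k] that by (auto simp: P_def)
    fix k u z assume u: "u \<in> span (B \<union> (y \<circ> r) ` {..<k})" and "z \<in> span ((y \<circ> r) ` {k..})"
    then obtain a n where a: "z = (\<Sum>i<n. scl (a i) ((y \<circ> r) i))" "\<And>i. i \<notin> {k..} \<Longrightarrow> a i = 0"
      using span_image_sum by metis
    have "z = (\<Sum>i\<in>{k..<max k n}. scl (a i) (y (r i)))"
      unfolding a(1) using a(2) by (intro sum.mono_neutral_cong_right) auto
    then have "norm u \<le> c (max k n) / c k * norm (u + z)" using tele[OF u] by simp
    also have "\<dots> \<le> (1 + e) * norm (u + z)"
      using c(1)[of k] c(2)[of "max k n"] assms(2)
      by (intro mult_right_mono) (auto simp: divide_le_eq intro: order_trans[OF less_imp_le] mult_left_mono)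
    finally show "norm u \<le> (1 + e) * norm (u + z)" .
  qed
qed

text \<open>Separation of initial segments bounds the coefficients of \<open>z\<close> by its norm, so geometric decay makes the
  finitely many functionals that norm \<open>span B\<close> small on every \<open>z\<close> in a late tail.\<close>

lemma tail_almost_orthogonal:
  assumes "0 < e"
    and small: "\<And>k i. i \<le> k \<Longrightarrow> norm (g i (y (r k))) \<le> (1 / 2) ^ k"
    and sep: "\<And>k u z. u \<in> span ((y \<circ> r) ` {..<k}) \<Longrightarrow> z \<in> span ((y \<circ> r) ` {k..}) \<Longrightarrow>
       norm u \<le> (1 + e) * norm (u + z)"
    and "finite B"
  shows "\<exists>j. \<forall>u\<in>span B. \<forall>z\<in>span ((y \<circ> r) ` {j..}). norm u \<le> (1 + e) * norm (u + z)"
proof -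
  define q where "q = 1 + e"
  define \<eta> where "\<eta> = (1 - 1 / q) / 2"
  have q: "1 < q" using assms(1) by (simp add: q_def)
  then have \<eta>: "0 < \<eta>" by (simp add: \<eta>_def)
  obtain N where N: "\<And>u. u \<in> span B \<Longrightarrow> \<exists>k\<le>N. (1 - \<eta>) * norm u \<le> norm (g k u)"
    using finitely_many_norming[OF assms(4) \<eta>] by blast
  have "(\<lambda>j. (8 * q / d) * (1 / 2) ^ j) \<longlonglongrightarrow> (8 * q / d) * 0"
    by (intro tendsto_intros LIMSEQ_power_zero) simp
  then have "\<forall>\<^sub>F j in sequentially. (8 * q / d) * (1 / 2) ^ j < \<eta>"
    using \<eta> by (auto dest: order_tendstoD(2))
  then obtain j where j: "N \<le> j" "(8 * q / d) * (1 / 2) ^ j < \<eta>"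
    using eventually_happens[OF eventually_conj[OF eventually_ge_at_top[of N]]] by fastforce
  have bound: "norm (g k z) \<le> (4 * q / d) * (1 / 2) ^ j * norm z"
    if z: "z \<in> span ((y \<circ> r) ` {j..})" and k: "k \<le> N" for z k
  proof -
    obtain a n where a: "z = (\<Sum>i<n. scl (a i) ((y \<circ> r) i))" "\<And>i. i \<notin> {j..} \<Longrightarrow> a i = 0"
      using span_image_sum[OF z] by metis
    define S where "S m = (\<Sum>i<m. scl (a i) ((y \<circ> r) i))" for m
    have initial: "norm (S m) \<le> q * norm z" if "m \<le> n" for m
    proof -
      have "z = S m + (\<Sum>i\<in>{m..<n}. scl (a i) ((y \<circ> r) i))"
        unfolding a(1) S_def using that by (simp add: lessThan_atLeast0 sum.atLeastLessThan_concat)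
      moreover have "S m \<in> span ((y \<circ> r) ` {..<m})"
        "(\<Sum>i\<in>{m..<n}. scl (a i) ((y \<circ> r) i)) \<in> span ((y \<circ> r) ` {m..})"
        unfolding S_def by (rule span_sum, rule span_scale, rule span_base, simp)+
      ultimately show ?thesis using sep unfolding q_def by metis
    qed
    have coeff: "norm (a i) \<le> 2 * q * norm z / d" if "i < n" for i
    proof -
      have "norm (scl (a i) (y (r i))) = norm (S (Suc i) - S i)"
        by (simp add: S_def)
      also have "\<dots> \<le> norm (S (Suc i)) + norm (S i)" by (rule norm_triangle_ineq4)
      also have "\<dots> \<le> q * norm z + q * norm z"
        using initial[of i] initial[of "Suc i"] that by simp
      finally have "norm (scl (a i) (y (r i))) \<le> 2 * q * norm z" by simp
      moreover have "norm (a i) * d \<le> norm (scl (a i) (y (r i)))"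
        by (simp add: norm_scl d(2) mult_left_mono)
      ultimately show ?thesis using d(1) by (simp add: pos_le_divide_eq)
    qed
    have geo: "(\<Sum>i\<in>{j..<m}. (1 / 2 :: real) ^ i) \<le> 2 * (1 / 2) ^ j" for m
    proof (cases "j \<le> m")
      case True
      then have "(\<Sum>i\<in>{j..<m}. (1 / 2 :: real) ^ i) = 2 * (1 / 2) ^ j - 2 * (1 / 2) ^ m"
        by (induction m rule: dec_induct) auto
      then show ?thesis by simp
    qed simp
    have "z = (\<Sum>i\<in>{j..<n}. scl (a i) (y (r i)))"
      unfolding a(1) using a(2) by (intro sum.mono_neutral_cong_right) auto
    then have "norm (g k z) \<le> (\<Sum>i\<in>{j..<n}. norm (g k (scl (a i) (y (r i)))))"
      by (simp add: g_sum norm_sum)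
    also have "\<dots> \<le> (\<Sum>i\<in>{j..<n}. (2 * q * norm z / d) * (1 / 2) ^ i)"
    proof (rule sum_mono)
      fix i assume i: "i \<in> {j..<n}"
      then have "norm (g k (y (r i))) \<le> (1 / 2) ^ i" using k j(1) by (intro small) auto
      then show "norm (g k (scl (a i) (y (r i)))) \<le> (2 * q * norm z / d) * (1 / 2) ^ i"
        unfolding g_scl norm_mult using coeff[of i] i q d(1) by (intro mult_mono) auto
    qed
    also have "\<dots> = (2 * q * norm z / d) * (\<Sum>i\<in>{j..<n}. (1 / 2) ^ i)"
      by (simp add: sum_distrib_left)
    also have "\<dots> \<le> (2 * q * norm z / d) * (2 * (1 / 2) ^ j)"
      using q d(1) by (intro mult_left_mono geo) auto
    finally show ?thesis by (simp add: algebra_simps)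
  qed
  show ?thesis
  proof (intro exI ballI)
    fix u z assume u: "u \<in> span B" and z: "z \<in> span ((y \<circ> r) ` {j..})"
    obtain k where k: "k \<le> N" "(1 - \<eta>) * norm u \<le> norm (g k u)" using N[OF u] by blast
    have "norm u \<le> q * norm (u + z)"
    proof (rule almost_orthogonalI[OF q])
      show "(1 - (1 - 1 / q) / 2) * norm u \<le> norm (g k u)" using k(2) by (simp add: \<eta>_def)
      assume "norm z < 2 * norm u"
      then have "(4 * q / d) * (1 / 2) ^ j * norm z \<le> (4 * q / d) * (1 / 2) ^ j * (2 * norm u)"
        using q d(1) by (intro mult_left_mono) auto
      also have "\<dots> = ((8 * q / d) * (1 / 2) ^ j) * norm u" by simp
      also have "\<dots> \<le> \<eta> * norm u" using j(2) by (intro mult_right_mono) auto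
      finally show "norm (g k z) \<le> (1 - 1 / q) / 2 * norm u"
        using bound[OF z k(1)] by (simp add: \<eta>_def)
    qed
    then show "norm u \<le> (1 + e) * norm (u + z)" by (simp add: q_def)
  qed
qed

end

end


section \<open>A criterion for basic sequences\<close>

text \<open>The scalars inherit completeness from the complex numbers, in which their image is closed.\<close>

lemma scalar_Cauchy_convergent:
  fixes a :: "nat \<Rightarrow> 'k::real_or_complex_field"
  assumes "Cauchy a"
  obtains l where "a \<longlonglongrightarrow> l"
proof -
  obtain l r where "strict_mono (r :: nat \<Rightarrow> nat)" "(a \<circ> r) \<longlonglongrightarrow> l"
    using scalar_bounded_convergent_subsequence[OF cauchy_imp_bounded[OF assms]] .
  then have "a \<longlonglongrightarrow> l"
    using Cauchy_converges_subseq[OF assms] by blast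
  then show thesis by (rule that)
qed

text \<open>Grunblum's criterion. The hypothesis bounds all partial sums by \<open>C\<close> times the norm of the full sum. Hence
  the coefficients of finite combinations approximating \<open>y\<close> converge, and they do so uniformly in the number
  of terms, so that the limit coefficients expand \<open>y\<close>.\<close>

lemma (in banach_space_over) basic_sequence_if_separated:
  assumes nz: "\<And>k. u k \<noteq> 0"
    and sep: "\<And>k v z. v \<in> span (u ` {..<k}) \<Longrightarrow> z \<in> span (u ` {k..}) \<Longrightarrow> norm v \<le> C * norm (v + z)"
  shows "basic_sequence scl u" "basis_constant scl u \<le> ereal C"
proof -
  define S where "S a n = (\<Sum>k<n. scl (a k) (u k))" for a n
  have S_diff: "S (\<lambda>k. a k - b k) n = S a n - S b n" for a b n
    by (simp add: S_def scale_left_diff_distrib sum_subtractf)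
  have S_Suc: "scl (a n) (u n) = S a (Suc n) - S a n" for a n
    by (simp add: S_def)
  have mono: "norm (S a n) \<le> C * norm (S a m)" if "n \<le> m" for a n m
  proof -
    have "S a m = S a n + (\<Sum>k\<in>{n..<m}. scl (a k) (u k))"
      using that by (simp add: S_def lessThan_atLeast0 sum.atLeastLessThan_concat)
    moreover have "S a n \<in> span (u ` {..<n})" "(\<Sum>k\<in>{n..<m}. scl (a k) (u k)) \<in> span (u ` {n..})"
      unfolding S_def by (rule span_sum, rule span_scale, rule span_base, simp)+
    ultimately show ?thesis using sep by metis
  qed
  have "norm (u 0) \<le> C * norm (u 0)"
    using sep[of "u 0" 1 0] by (simp add: span_base span_zero)
  then have C: "1 \<le> C" using nz[of 0] by simp
  have sums_iff: "(\<lambda>k. scl (a k) (u k)) sums y \<longleftrightarrow> S a \<longlonglongrightarrow> y" for a y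
    by (simp add: sums_def S_def[abs_def])
  have bound: "norm (S a n) \<le> C * norm y" if "S a \<longlonglongrightarrow> y" for a n y
  proof -
    have "(\<lambda>m. C * norm (S a m)) \<longlonglongrightarrow> C * norm y" using that by (intro tendsto_intros)
    then show ?thesis
      by (rule LIMSEQ_le_const) (use mono in blast)
  qed
  have unique: "a = b" if ab: "S a \<longlonglongrightarrow> y" "S b \<longlonglongrightarrow> y" for a b y
  proof (rule ext)
    fix n
    have "(\<lambda>n. S a n - S b n) \<longlonglongrightarrow> y - y" using ab by (rule tendsto_diff)
    moreover have "(\<lambda>n. S a n - S b n) = S (\<lambda>k. a k - b k)" by (rule ext) (simp add: S_diff)
    ultimately have "S (\<lambda>k. a k - b k) \<longlonglongrightarrow> 0" by simp
    then have "S (\<lambda>k. a k - b k) n = 0" for n using bound by fastforce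
    then have "scl (a n - b n) (u n) = 0"
      using S_Suc[of "\<lambda>k. a k - b k" n] by simp
    then show "a n = b n" using nz by simp
  qed
  have exist: "\<exists>a. S a \<longlonglongrightarrow> y" if y: "y \<in> closure (span (range u))" for y
  proof -
    obtain w where w: "\<And>j. w j \<in> span (range u)" "w \<longlonglongrightarrow> y"
      using y unfolding closure_sequential by blast
    have "\<exists>a n. \<forall>m\<ge>n. S a m = w j" for j
    proof -
      obtain a n where a: "w j = (\<Sum>k<n. scl (a k) (u k))"
        using span_image_sum[OF w(1)] by metis
      have "S (\<lambda>k. if k < n then a k else 0) m = w j" if "n \<le> m" for m
        unfolding S_def a using that by (intro sum.mono_neutral_cong_right) auto
      then show ?thesis by blast
    qed
    then obtain a n where a: "\<And>j m. n j \<le> m \<Longrightarrow> S (a j) m = w j" by metis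
    have close: "norm (S (a j) m - S (a i) m) \<le> C * norm (w j - w i)" for i j m
    proof -
      let ?l = "max m (max (n i) (n j))"
      have "norm (S (\<lambda>k. a j k - a i k) m) \<le> C * norm (S (\<lambda>k. a j k - a i k) ?l)"
        by (rule mono) simp
      then show ?thesis by (simp add: S_diff a)
    qed
    have "\<exists>b. (\<lambda>j. a j k) \<longlonglongrightarrow> b" for k
    proof -
      have "Cauchy (\<lambda>j. a j k)"
      proof (rule metric_CauchyI)
        fix e :: real assume e: "0 < e"
        then have "0 < e * norm (u k) / (2 * C)" using nz C by simp
        then obtain M where M: "\<And>i j. M \<le> i \<Longrightarrow> M \<le> j \<Longrightarrow> dist (w i) (w j) < e * norm (u k) / (2 * C)"
          using metric_CauchyD[OF LIMSEQ_imp_Cauchy[OF w(2)]] by blast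
        have "dist (a i k) (a j k) < e" if "M \<le> i" "M \<le> j" for i j
        proof -
          have "norm (a i k - a j k) * norm (u k) = norm (scl (a i k - a j k) (u k))"
            by (simp add: norm_scl)
          also have "scl (a i k - a j k) (u k) = (S (a i) (Suc k) - S (a j) (Suc k)) - (S (a i) k - S (a j) k)"
            by (simp add: S_def scale_left_diff_distrib)
          also have "norm \<dots> \<le> norm (S (a i) (Suc k) - S (a j) (Suc k)) + norm (S (a i) k - S (a j) k)"
            by (rule norm_triangle_ineq4)
          also have "\<dots> \<le> C * norm (w i - w j) + C * norm (w i - w j)"
            by (intro add_mono close)
          also have "\<dots> < e * norm (u k)"
            using M[OF that] C by (simp add: dist_norm field_simps)
          finally show ?thesis using nz by (simp add: dist_norm)
        qed
        then show "\<exists>M. \<forall>m\<ge>M. \<forall>n\<ge>M. dist (a m k) (a n k) < e" by blast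
      qed
      then show ?thesis using scalar_Cauchy_convergent by metis
    qed
    then obtain b where b: "\<And>k. (\<lambda>j. a j k) \<longlonglongrightarrow> b k" by metis
    have lim: "(\<lambda>i. S (a i) m) \<longlonglongrightarrow> S b m" for m
      unfolding S_def by (intro tendsto_sum tendsto_scl b tendsto_const)
    have close': "norm (S (a j) m - S b m) \<le> C * norm (w j - y)" for j m
    proof (rule LIMSEQ_le)
      show "(\<lambda>i. norm (S (a j) m - S (a i) m)) \<longlonglongrightarrow> norm (S (a j) m - S b m)"
        by (intro tendsto_intros lim)
      show "(\<lambda>i. C * norm (w j - w i)) \<longlonglongrightarrow> C * norm (w j - y)"
        by (intro tendsto_intros w(2))
    qed (use close in blast)
    have "S b \<longlonglongrightarrow> y"
    proof (rule metric_LIMSEQ_I)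
      fix e :: real assume e: "0 < e"
      then have "0 < e / (C + 1)" using C by simp
      then obtain j where "dist (w j) y < e / (C + 1)"
        using metric_LIMSEQ_D[OF w(2)] by blast
      then have j: "(C + 1) * norm (w j - y) < e"
        using C by (simp add: dist_norm pos_less_divide_eq mult.commute)
      have "dist (S b m) y < e" if "n j \<le> m" for m
      proof -
        have "S b m - y = (w j - y) - (S (a j) m - S b m)" by (simp add: a that)
        then have "norm (S b m - y) \<le> norm (w j - y) + norm (S (a j) m - S b m)"
          by (metis norm_triangle_ineq4)
        then show ?thesis using close'[of j m] j by (simp add: dist_norm distrib_right)
      qed
      then show "\<exists>no. \<forall>n\<ge>no. dist (S b n) y < e" by blast
    qed
    then show ?thesis by blast
  qed
  show "basic_sequence scl u"
    unfolding basic_sequence_def closed_span_def sums_iff using exist unique by blast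
  have "norm (\<Sum>k<n. scl (basis_coeff scl u y k) (u k)) \<le> C"
    if y: "y \<in> closed_span scl (range u)" "norm y \<le> 1" for n y
  proof -
    obtain a where a: "S a \<longlonglongrightarrow> y" using exist y(1) unfolding closed_span_def by blast
    then have "basis_coeff scl u y = a"
      unfolding basis_coeff_def sums_iff using unique by blast
    then show ?thesis
      using order_trans[OF bound[OF a, of n] mult_left_mono[OF y(2), of C]] C by (simp add: S_def)
  qed
  then show "basis_constant scl u \<le> ereal C"
    unfolding basis_constant_def by (intro SUP_least) auto
qed


section \<open>The coordinate space of a norming sequence of functionals\<close>

text \<open>The bounded scalar sequences with the supremum norm; the evaluations are norming.\<close>

definition scale_bcontfun ::
  "'k::real_or_complex_field \<Rightarrow> (nat \<Rightarrow>\<^sub>C 'k) \<Rightarrow> (nat \<Rightarrow>\<^sub>C 'k)"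
  where "scale_bcontfun c v = Bcontfun (\<lambda>k. c * apply_bcontfun v k)"

lemma apply_Bcontfun_nat:
  assumes "\<And>k::nat. norm (f k) \<le> b"
  shows "apply_bcontfun (Bcontfun f) k = f k"
proof -
  have "f \<in> bcontfun" using assms by (intro bcontfun_normI[of _ b]) auto
  then show ?thesis by (simp add: Bcontfun_inverse)
qed

lemma apply_scale_bcontfun [simp]: "apply_bcontfun (scale_bcontfun c v) k = c * apply_bcontfun v k"
  unfolding scale_bcontfun_def
  by (rule apply_Bcontfun_nat[of _ "norm c * norm v"]) (simp add: norm_mult mult_left_mono norm_bounded)

lemma norming_sequence_bcontfun:
  "norming_sequence (scale_bcontfun :: 'k::real_or_complex_field \<Rightarrow> _) (\<lambda>k v. apply_bcontfun v k)"
proof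
  fix a b :: 'k and v w :: "nat \<Rightarrow>\<^sub>C 'k" and k :: nat and t :: real
  show "scale_bcontfun a (v + w) = scale_bcontfun a v + scale_bcontfun a w"
    "scale_bcontfun (a + b) v = scale_bcontfun a v + scale_bcontfun b v"
    "scale_bcontfun a (scale_bcontfun b v) = scale_bcontfun (a * b) v"
    "scale_bcontfun 1 v = v"
    by (rule bcontfun_eqI; simp add: algebra_simps)+
  show "apply_bcontfun (v + w) k = apply_bcontfun v k + apply_bcontfun w k"
    "apply_bcontfun (scale_bcontfun a v) k = a * apply_bcontfun v k"
    by simp_all
  show "norm (apply_bcontfun v k) \<le> norm v" by (rule norm_bounded)
  show "\<exists>k. t < norm (apply_bcontfun v k)" if "t < norm v"
    using norm_bound[of v t] that by (meson not_less)
  have le: "norm (scale_bcontfun c u) \<le> norm c * norm u" for c :: 'k and u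
    by (rule norm_bound) (simp add: norm_mult mult_left_mono norm_bounded)
  show "norm (scale_bcontfun a v) = norm a * norm v"
  proof (cases "a = 0")
    case True
    then show ?thesis using le[of a v] by (simp add: antisym)
  next
    case False
    have "v = scale_bcontfun (1 / a) (scale_bcontfun a v)"
      by (rule bcontfun_eqI) (simp add: False)
    then have "norm v \<le> norm (1 / a) * norm (scale_bcontfun a v)" by (metis le)
    then have "norm a * norm v \<le> norm (scale_bcontfun a v)"
      using False by (simp add: norm_divide field_simps)
    then show ?thesis using le[of a v] by simp
  qed
qed


section \<open>Markushevich bases have the finite dimensional separation property\<close>

context banach_space_over
begin

text \<open>Finite combinations with coefficients from a countable dense set of scalars.\<close>

lemma fundamental_countable_dense:
  assumes "fundamental scl x"
  shows "\<exists>d :: nat \<Rightarrow> 'x. \<forall>v. \<forall>e>0. \<exists>n. norm (v - d n) < e"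
proof -
  obtain Q :: "'k set" where Q: "countable Q" "\<And>a e. 0 < e \<Longrightarrow> \<exists>q\<in>Q. norm (a - q) < e"
    using scalar_countable_dense by blast
  define T where "T = rec_nat {0} (\<lambda>n S. (\<lambda>(t, c). t + scl c (x n)) ` (S \<times> Q))"
  have T: "T 0 = {0}" "T (Suc n) = (\<lambda>(t, c). t + scl c (x n)) ` (T n \<times> Q)" for n
    by (simp_all add: T_def)
  have count: "countable (T n)" for n
    by (induction n) (auto simp: T Q(1))
  have approx: "\<exists>t\<in>T n. norm ((\<Sum>k<n. scl (a k) (x k)) - t) < e" if "0 < e" for a n e
    using that
  proof (induction n arbitrary: e)
    case (Suc n)
    obtain t where t: "t \<in> T n" "norm ((\<Sum>k<n. scl (a k) (x k)) - t) < e / 2"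
      using Suc.IH[of "e / 2"] Suc.prems by auto
    have "0 < e / 2 / (norm (x n) + 1)"
      using Suc.prems by (simp add: add_nonneg_pos)
    then obtain q where q: "q \<in> Q" "norm (a n - q) < e / 2 / (norm (x n) + 1)"
      using Q(2) by blast
    have "norm (a n - q) * norm (x n) \<le> norm (a n - q) * (norm (x n) + 1)"
      by (simp add: mult_left_mono)
    also have "\<dots> < e / 2"
      using q(2) by (subst (asm) pos_less_divide_eq) (simp_all add: add_nonneg_pos)
    finally have *: "norm (scl (a n - q) (x n)) < e / 2" by (simp add: norm_scl)
    have "(\<Sum>k<Suc n. scl (a k) (x k)) - (t + scl q (x n))
        = ((\<Sum>k<n. scl (a k) (x k)) - t) + scl (a n - q) (x n)"
      by (simp add: scale_left_diff_distrib)
    then have "norm ((\<Sum>k<Suc n. scl (a k) (x k)) - (t + scl q (x n)))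
        \<le> norm ((\<Sum>k<n. scl (a k) (x k)) - t) + norm (scl (a n - q) (x n))"
      by (simp only: norm_triangle_ineq)
    then have "norm ((\<Sum>k<Suc n. scl (a k) (x k)) - (t + scl q (x n))) < e"
      using t(2) * by linarith
    moreover have "t + scl q (x n) \<in> T (Suc n)" 
      unfolding T by (rule image_eqI[of _ _ "(t, q)"]) (use t(1) q(1) in auto)
    ultimately show ?case by blast
  qed (simp add: T)
  let ?D = "\<Union>n. T n"
  have "countable ?D" using count by blast
  moreover have "?D \<noteq> {}" using T(1) by blast
  ultimately have D: "range (from_nat_into ?D) = ?D" by (rule range_from_nat_into[rotated])
  show ?thesis
  proof (rule exI[of _ "from_nat_into ?D"], intro allI impI)
    fix v and e :: real assume e: "0 < e"
    have "v \<in> closure (span (range x))" using assms by (simp add: fundamental_def closed_span_def)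
    then obtain w where w: "w \<in> span (range x)" "dist w v < e / 2"
      using e unfolding closure_approachable by (meson half_gt_zero)
    obtain a n where "w = (\<Sum>k<n. scl (a k) (x k))" using span_image_sum[OF w(1)] by metis
    then obtain t where t: "t \<in> T n" "norm (w - t) < e / 2"
      using approx[of "e / 2" n a] e by auto
    have "norm (v - t) < e"
      using norm_triangle_ineq[of "v - w" "w - t"] t(2) w(2) by (simp add: dist_norm norm_minus_commute)
    moreover have "t \<in> range (from_nat_into ?D)" unfolding D using t(1) by blast
    ultimately show "\<exists>n. norm (v - from_nat_into ?D n) < e" by blast
  qed
qed

context
  fixes x :: "nat \<Rightarrow> 'x"
  assumes fms: "fundamental_minimal_system scl x"
begin

lemma coord_simps:
  "coord scl x i (u + v) = coord scl x i u + coord scl x i v"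
  "coord scl x i (u - v) = coord scl x i u - coord scl x i v"
  "coord scl x i (scl c v) = c * coord scl x i v"
  "coord scl x i 0 = 0"
  "coord scl x i (x j) = (if i = j then 1 else 0)"
  "bounded_linear (coord scl x i)"
proof -
  have b: "biorthogonal scl x (coord scl x)"
    using fms banach_space_over_axioms by (intro biorthogonal_coord)
  then show bl: "bounded_linear (coord scl x i)"
    and "coord scl x i (scl c v) = c * coord scl x i v"
    and "coord scl x i (x j) = (if i = j then 1 else 0)"
    by (auto simp: biorthogonal_def dual_functional_def)
  then show "coord scl x i (u + v) = coord scl x i u + coord scl x i v"
    "coord scl x i (u - v) = coord scl x i u - coord scl x i v" "coord scl x i 0 = 0"
    by (simp_all add: linear_simps)
qed

lemma coord_sum: "coord scl x i (\<Sum>j\<in>I. f j) = (\<Sum>j\<in>I. coord scl x i (f j))"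
  by (induction I rule: infinite_finite_induct) (auto simp: coord_simps)

lemma system_nonzero: "x i \<noteq> 0"
  using coord_simps(4,5)[of i] by (metis one_neq_zero)

text \<open>The functionals norm a dense sequence and hence everything. The coordinate functionals are interleaved
  so that entrywise limits of basis vectors are controlled by totality.\<close>

lemma norming_sequence_with_coords:
  shows "\<exists>F. norming_sequence scl F \<and> (\<forall>i. \<exists>k c. c \<noteq> 0 \<and> (\<forall>v. F k v = c * coord scl x i v))"
proof -
  have fund: "fundamental scl x" using fms by (simp add: fundamental_minimal_system_def)
  obtain d :: "nat \<Rightarrow> 'x" where d: "\<And>v e. 0 < e \<Longrightarrow> \<exists>n. norm (v - d n) < e"
    using fundamental_countable_dense[OF fund] by auto
  have "\<forall>y. \<exists>g. (\<forall>u v. g (u + v) = g u + g v) \<and> (\<forall>c u. g (scl c u) = c * g u) \<and>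
    (\<forall>u. norm (g u) \<le> norm u) \<and> norm (g y) = norm y"
    using norming_functional by blast
  from choice[OF this] obtain G where G: "\<And>y u v. G y (u + v) = G y u + G y v" "\<And>y c u. G y (scl c u) = c * G y u"
    "\<And>y u. norm (G y u) \<le> norm u" "\<And>y. norm (G y y) = norm y" by blast
  define h where "h i = 1 / (1 + onorm (coord scl x i))" for i
  have h: "0 < h i" "norm (of_real (h i) * coord scl x i v) \<le> norm v" for i v
  proof -
    have "0 \<le> onorm (coord scl x i)" by (rule onorm_pos_le[OF coord_simps(6)])
    then show "0 < h i" by (simp add: h_def)
    have "norm (coord scl x i v) \<le> onorm (coord scl x i) * norm v"
      by (rule onorm[OF coord_simps(6)])
    then have "norm (coord scl x i v) \<le> (1 + onorm (coord scl x i)) * norm v"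
      by (simp add: distrib_right add_increasing)
    then have "h i * norm (coord scl x i v) \<le> norm v"
      using \<open>0 \<le> onorm (coord scl x i)\<close>
      by (simp add: h_def pos_divide_le_eq add_pos_nonneg mult.commute)
    then show "norm (of_real (h i) * coord scl x i v) \<le> norm v"
      using \<open>0 < h i\<close> by (simp add: norm_mult)
  qed
  define F where "F k = (if even k then G (d (k div 2))
    else (\<lambda>v. of_real (h (k div 2)) * coord scl x (k div 2) v))" for k :: nat
  have F: "F (2 * k) = G (d k)" "F (2 * k + 1) = (\<lambda>v. of_real (h k) * coord scl x k v)" for k
    by (simp_all add: F_def)
  show ?thesis
  proof (intro exI[of _ F] conjI allI)
    show "norming_sequence scl F"
    proof
      fix k u v c
      show "F k (u + v) = F k u + F k v" "F k (scl c u) = c * F k u" "norm (F k u) \<le> norm u"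
        using G h by (auto simp: F_def coord_simps distrib_left)
    next
      fix t and v :: 'x assume "t < norm v"
      then have "0 < (norm v - t) / 2" by simp
      then obtain n where n: "norm (v - d n) < (norm v - t) / 2" using d by blast
      have "v = (v - d n) + d n" by simp
      then have "norm v \<le> norm (v - d n) + norm (d n)" by (metis norm_triangle_ineq)
      moreover have "G (d n) (d n) = G (d n) (d n - v) + G (d n) v"
        using G(1)[of "d n" "d n - v" v] by simp
      then have "norm (d n) \<le> norm (d n - v) + norm (G (d n) v)"
        using norm_triangle_ineq[of "G (d n) (d n - v)" "G (d n) v"] G(3)[of "d n" "d n - v"] G(4)[of "d n"]
        by simp
      ultimately have "t < norm (G (d n) v)" using n by (simp add: norm_minus_commute[of v])
      then show "\<exists>k. t < norm (F k v)" using F(1) by metis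
    qed
    show "\<exists>k c. c \<noteq> 0 \<and> (\<forall>v. F k v = c * coord scl x i v)" for i
      using h(1)[of i] F(2)[of i] by (intro exI[of _ "2 * i + 1"] exI[of _ "of_real (h i)"]) simp
  qed
qed

text \<open>The same constant \<open>C\<close> and the same limit sequence \<open>\<Phi>\<close> serve all subspaces \<open>Z\<close> and all \<open>\<epsilon>\<close>; only the
  selected subsequence depends on \<open>\<epsilon>\<close>.\<close>

lemma markushevich_basis_imp_fds:
  assumes tot: "total scl x"
  shows "finite_dim_separation_property scl x"
proof -
  obtain F where ns: "norming_sequence scl F"
    and Fcoord: "\<And>i. \<exists>k c. c \<noteq> 0 \<and> (\<forall>v. F k v = c * coord scl x i v)"
    using norming_sequence_with_coords by auto
  interpret F: norming_sequence scl F by (rule ns)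
  interpret Y: norming_sequence "scale_bcontfun :: 'k \<Rightarrow> _" "\<lambda>k v. apply_bcontfun v k"
    by (rule norming_sequence_bcontfun)
  define J where "J v = Bcontfun (\<lambda>k. F k v)" for v
  have J: "apply_bcontfun (J v) k = F k v" for v k
    unfolding J_def by (rule apply_Bcontfun_nat) (rule F.g_le)
  have J_add: "J (u + v) = J u + J v" and J_scl: "J (scl c v) = scale_bcontfun c (J v)" for u v c
    by (rule bcontfun_eqI; simp add: J F.g_add F.g_scl)+
  have J_diff: "J (u - v) = J u - J v" for u v
    using J_add[of "u - v" v] by simp
  have J_norm: "norm (J v) = norm v" for v
  proof (rule antisym)
    show "norm (J v) \<le> norm v" by (rule norm_bound) (simp add: J F.g_le)
    have "\<not> norm (J v) < norm v"
    proof
      assume "norm (J v) < norm v"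
      then obtain k where "norm (J v) < norm (F k v)" using F.g_norming by blast
      then show False using norm_bounded[of "J v" k] by (simp add: J)
    qed
    then show "norm v \<le> norm (J v)" by simp
  qed
  have J_span: "J v \<in> W" if "v \<in> span A" "Y.subspace W" "J ` A \<subseteq> W" for v A W
  proof -
    have "J 0 = 0" using J_norm[of 0] by simp
    then have "subspace {v. J v \<in> W}"
      using that(2) by (auto intro!: subspaceI simp: J_add J_scl Y.subspace_0 Y.subspace_add Y.subspace_scale)
    then have "span A \<subseteq> {v. J v \<in> W}" using that(3) by (intro span_minimal) auto
    then show ?thesis using that(1) by blast
  qed

  define e where "e n = scl (of_real (1 / norm (x n))) (x n)" for n
  have e: "norm (e n) = 1" for n
    using system_nonzero by (simp add: e_def norm_scl norm_divide)
  obtain s p where s: "strict_mono (s :: nat \<Rightarrow> nat)" and p: "\<And>k. (\<lambda>n. F k (e (s n))) \<longlonglongrightarrow> p k"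
  proof -
    obtain \<phi> :: "'k \<Rightarrow> complex" where \<phi>: "\<And>a b. \<phi> (a - b) = \<phi> a - \<phi> b" "\<And>a. norm (\<phi> a) = norm a"
      by (rule scalar_embedding) blast
    have "norm (\<phi> (F k (e n))) \<le> 1" for k n using F.g_le[of k "e n"] by (simp add: \<phi>(2) e)
    have "\<exists>s::nat \<Rightarrow> nat. strict_mono s \<and> (\<forall>k. \<exists>l. (\<lambda>n. \<phi> (F k (e (s n)))) \<longlonglongrightarrow> l)"
    proof (rule function_convergent_subsequence[of "UNIV :: nat set" "\<lambda>n k. \<phi> (F k (e n))" 1])
      show "norm (\<phi> (F k (e n))) \<le> 1" for n k by fact
      fix s :: "nat \<Rightarrow> nat"
      assume s: "strict_mono s" "\<And>k. k \<in> UNIV \<Longrightarrow> \<exists>l. (\<lambda>n. \<phi> (F k (e (s n)))) \<longlonglongrightarrow> l"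
      show ?thesis by (intro exI[of _ s] conjI allI s UNIV_I)
    qed simp
    then obtain s where s: "strict_mono (s :: nat \<Rightarrow> nat)"
        "\<forall>k. \<exists>l. (\<lambda>n. \<phi> (F k (e (s n)))) \<longlonglongrightarrow> l"
      by (elim exE conjE)
    have "\<exists>l. (\<lambda>n. F k (e (s n))) \<longlonglongrightarrow> l" for k
    proof -
      obtain l where "(\<lambda>n. \<phi> (F k (e (s n)))) \<longlonglongrightarrow> l" using s(2) by blast
      then have "Cauchy (\<lambda>n. \<phi> (F k (e (s n))))" by (rule LIMSEQ_imp_Cauchy)
      then have "Cauchy (\<lambda>n. F k (e (s n)))"
        by (simp add: Cauchy_def dist_norm \<phi>(2) flip: \<phi>(1))
      then show ?thesis by (rule scalar_Cauchy_convergent) blast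
    qed
    then have "\<forall>k. \<exists>l. (\<lambda>n. F k (e (s n))) \<longlonglongrightarrow> l" by blast
    from choice[OF this] obtain p where "\<forall>k. (\<lambda>n. F k (e (s n))) \<longlonglongrightarrow> p k" ..
    then have "\<And>k. (\<lambda>n. F k (e (s n))) \<longlonglongrightarrow> p k" by blast
    with s(1) show thesis by (rule that)
  qed
  define \<Phi> where "\<Phi> = Bcontfun p"
  have "norm (p k) \<le> 1" for k
    by (rule LIMSEQ_le_const2[OF tendsto_norm[OF p]]) (metis F.g_le e)
  then have \<Phi>: "apply_bcontfun \<Phi> k = p k" for k
    unfolding \<Phi>_def by (rule apply_Bcontfun_nat)

  obtain C where C: "1 \<le> C" "\<And>v c. norm v \<le> C * norm (J v + scale_bcontfun c \<Phi>)"
  proof (cases "\<Phi> \<in> range J")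
    case True
    then obtain y where y: "\<Phi> = J y" by blast
    have "coord scl x i y = 0" for i
    proof -
      obtain k c where k: "c \<noteq> 0" "\<And>v. F k v = c * coord scl x i v" using Fcoord by blast
      have "F k (e (s n)) = 0" if "Suc i \<le> n" for n
        using that seq_suble[OF s, of n] by (simp add: k(2) e_def coord_simps)
      then have "\<forall>\<^sub>F n in sequentially. F k (e (s n)) = 0"
        by (rule eventually_sequentiallyI)
      then have "p k = 0" by (rule LIMSEQ_unique[OF p[of k] tendsto_eventually])
      moreover have "p k = F k y" using \<Phi>[of k] J[of y k] y by simp
      ultimately show ?thesis using k by simp
    qed
    then have "y = 0" using tot by (simp add: total_def)
    then have "\<Phi> = 0" using J_norm[of 0] y by simp
    then show thesis by (intro that[of 1]) (simp_all add: J_norm)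
  next
    case False
    have "Y.subspace (range J)"
    proof (rule Y.subspaceI)
      show "0 \<in> range J" using J_norm[of 0] by (intro image_eqI[of _ _ 0]) auto
      show "u + v \<in> range J" if "u \<in> range J" "v \<in> range J" for u v
        using that by (auto simp flip: J_add)
      show "scale_bcontfun c v \<in> range J" if "v \<in> range J" for c v
        using that by (auto simp flip: J_scl)
    qed
    moreover have "closed (range J)"
      unfolding closed_sequential_limits
    proof (intro allI impI, elim conjE)
      fix w l assume w: "\<forall>n. w n \<in> range J" "w \<longlonglongrightarrow> l"
      then have "\<forall>n. \<exists>v. w n = J v" by blast
      then obtain v where v: "\<And>n. w n = J (v n)" by metis
      have iso: "norm (w n - J u) = norm (v n - u)" for n u by (simp add: v J_norm flip: J_diff)
      have "Cauchy v"
        using LIMSEQ_imp_Cauchy[OF w(2)] iso by (simp add: Cauchy_def dist_norm v)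
      then obtain u where "v \<longlonglongrightarrow> u" unfolding Cauchy_convergent_iff convergent_def by blast
      then have "w \<longlonglongrightarrow> J u" by (simp add: tendsto_iff dist_norm iso)
      then have "l = J u" by (rule LIMSEQ_unique[OF w(2)])
      then show "l \<in> range J" by simp
    qed
    ultimately obtain \<delta> where d: "0 < \<delta>"
        "\<And>f c. f \<in> range J \<Longrightarrow> norm c * \<delta> \<le> norm (f + scale_bcontfun c \<Phi>)"
      using Y.closed_subspace_separated[of "range J" \<Phi>] False by auto
    show thesis
    proof (rule that[of "1 + norm \<Phi> / \<delta>"])
      show "1 \<le> 1 + norm \<Phi> / \<delta>" using d(1) by simp
      fix v c
      let ?w = "J v + scale_bcontfun c \<Phi>"
      have "norm (J v) \<le> norm ?w + norm c * norm \<Phi>"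
        using norm_triangle_ineq4[of ?w "scale_bcontfun c \<Phi>"] by (simp add: Y.norm_scl)
      moreover have "norm c * norm \<Phi> \<le> norm ?w / \<delta> * norm \<Phi>"
        using d by (intro mult_right_mono) (auto simp: pos_le_divide_eq)
      ultimately show "norm v \<le> (1 + norm \<Phi> / \<delta>) * norm ?w"
        by (simp add: J_norm distrib_right mult.commute)
    qed
  qed

  \<comment> \<open>The shifted vectors are entrywise null, and the estimate for \<open>C\<close> with \<open>c = - 1\<close> keeps them away from 0.\<close>
  define y where "y n = J (e (s n)) - \<Phi>" for n
  have y: "1 / C \<le> norm (y n)" for n
    using C(2)[of "e (s n)" "- 1"] C(1) by (simp add: y_def e divide_le_eq mult.commute)
  have null: "(\<lambda>n. apply_bcontfun (y n) k) \<longlonglongrightarrow> 0" for k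
    using LIM_zero[OF p[of k]] by (simp add: y_def J \<Phi>)

  have "fds_with scl x C"
    unfolding fds_with_def
  proof (intro allI impI, elim conjE)
    fix Z :: "'x set" and \<epsilon> :: real assume \<epsilon>: "0 < \<epsilon>"
    define \<eta> where "\<eta> = \<epsilon> / C"
    have \<eta>: "0 < \<eta>" "C * (1 + \<eta>) = C + \<epsilon>" using \<epsilon> C(1) by (auto simp: \<eta>_def field_simps)
    obtain r where r: "strict_mono r"
      "\<And>k i. i \<le> k \<Longrightarrow> norm (apply_bcontfun (y (r k)) i) \<le> (1 / 2) ^ k"
      "\<And>k u z. u \<in> Y.span ({\<Phi>} \<union> (y \<circ> r) ` {..<k}) \<Longrightarrow> z \<in> Y.span ((y \<circ> r) ` {k..}) \<Longrightarrow>
         norm u \<le> (1 + \<eta>) * norm (u + z)"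
      using Y.almost_orthogonal_subsequence[of "1 / C" y "{\<Phi>}" \<eta>] y null \<eta>(1) C(1) by auto
    let ?u = "x \<circ> (s \<circ> r)"
    have J_tail: "J v \<in> Y.span (insert \<Phi> ((y \<circ> r) ` I))" if "v \<in> span (?u ` I)" for v I
    proof (rule J_span[OF that Y.subspace_span], rule image_subsetI)
      fix w assume "w \<in> ?u ` I"
      then obtain k where k: "k \<in> I" "w = x (s (r k))" by auto
      have "w = scl (of_real (norm w)) (e (s (r k)))"
        using system_nonzero[of "s (r k)"] by (simp add: k(2) e_def)
      also have "J \<dots> = scale_bcontfun (of_real (norm w)) (\<Phi> + y (r k))"
        by (simp add: J_scl y_def)
      also have "\<dots> \<in> Y.span (insert \<Phi> ((y \<circ> r) ` I))"
        using k(1) by (intro Y.span_scale Y.span_add Y.span_base) auto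
      finally show "J w \<in> Y.span (insert \<Phi> ((y \<circ> r) ` I))" .
    qed
    \<comment> \<open>A tail vector \<open>z\<close> is a combination of shifted vectors up to a multiple of \<open>\<Phi>\<close>, which is moved to the
      side of \<open>v\<close>.\<close>
    have transfer: "norm v \<le> (C + \<epsilon>) * norm (v + z)"
      if sep: "\<And>u \<zeta>. u \<in> Y.span E \<Longrightarrow> \<zeta> \<in> Y.span ((y \<circ> r) ` I) \<Longrightarrow> norm u \<le> (1 + \<eta>) * norm (u + \<zeta>)"
        and E: "\<Phi> \<in> E" "J v \<in> Y.span E" and z: "z \<in> span (?u ` I)" for v z E I
    proof -
      obtain c where c: "J z - scale_bcontfun c \<Phi> \<in> Y.span ((y \<circ> r) ` I)"
        using J_tail[OF z] Y.span_breakdown_eq by blast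
      have "norm v \<le> C * norm (J v + scale_bcontfun c \<Phi>)" by (rule C(2))
      also have "norm (J v + scale_bcontfun c \<Phi>)
          \<le> (1 + \<eta>) * norm ((J v + scale_bcontfun c \<Phi>) + (J z - scale_bcontfun c \<Phi>))"
        using E c by (intro sep Y.span_add Y.span_scale) (auto intro: Y.span_base)
      also have "(J v + scale_bcontfun c \<Phi>) + (J z - scale_bcontfun c \<Phi>) = J (v + z)"
        by (simp add: J_add)
      finally show ?thesis
        using C(1) \<eta>(2) by (simp add: J_norm mult_left_mono flip: mult.assoc)
    qed
    have basic: "basic_sequence scl ?u" "basis_constant scl ?u \<le> ereal (C + \<epsilon>)"
    proof -
      have "norm v \<le> (C + \<epsilon>) * norm (v + z)"
        if "v \<in> span (?u ` {..<k})" "z \<in> span (?u ` {k..})" for k v z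
        using r(3)[of _ k] J_tail[OF that(1)] that(2) by (intro transfer) auto
      then show "basic_sequence scl ?u" "basis_constant scl ?u \<le> ereal (C + \<epsilon>)"
        using basic_sequence_if_separated[of ?u "C + \<epsilon>"] system_nonzero by (auto simp: comp_def)
    qed
    have "\<exists>j. \<forall>v\<in>D. \<forall>z\<in>closed_span scl (?u ` {k. j < k}). norm v \<le> (C + \<epsilon>) * norm (v + z)"
      if D: "finite_dim_subspace scl D" for D
    proof -
      obtain B where B: "finite B" "D = span B"
        using D unfolding finite_dim_subspace_def by blast
      have sep: "norm u \<le> (1 + \<eta>) * norm (u + z)"
        if "u \<in> Y.span ((y \<circ> r) ` {..<k})" "z \<in> Y.span ((y \<circ> r) ` {k..})" for k u z
        using r(3)[OF _ that(2)] that(1) Y.span_mono[of "(y \<circ> r) ` {..<k}" "{\<Phi>} \<union> (y \<circ> r) ` {..<k}"] by blast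
      have "\<exists>j. \<forall>u\<in>Y.span (insert \<Phi> (J ` B)). \<forall>z\<in>Y.span ((y \<circ> r) ` {j..}).
          norm u \<le> (1 + \<eta>) * norm (u + z)"
      proof (rule Y.tail_almost_orthogonal)
        show "0 < 1 / C" using C(1) by simp
        show "finite (insert \<Phi> (J ` B))" using B(1) by simp
      qed (fact y null \<eta>(1) r(2) sep)+
      then obtain j where j: "\<And>u z. u \<in> Y.span (insert \<Phi> (J ` B)) \<Longrightarrow> z \<in> Y.span ((y \<circ> r) ` {j..}) \<Longrightarrow>
          norm u \<le> (1 + \<eta>) * norm (u + z)"
        by blast
      have fin: "norm v \<le> (C + \<epsilon>) * norm (v + z)" if "v \<in> D" "z \<in> span (?u ` {k. j < k})" for v z
      proof (rule transfer)
        show "J v \<in> Y.span (insert \<Phi> (J ` B))"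
          using that(1) unfolding B(2)
          by (rule J_span[OF _ Y.subspace_span]) (auto intro: Y.span_base)
        show "z \<in> span (?u ` {j..})"
          by (rule subsetD[OF span_mono that(2)]) auto
      qed (use j in auto)
      have "norm v \<le> (C + \<epsilon>) * norm (v + z)" if v: "v \<in> D" and z: "z \<in> closed_span scl (?u ` {k. j < k})" for v z
      proof -
        obtain t where t: "\<And>n. t n \<in> span (?u ` {k. j < k})" "t \<longlonglongrightarrow> z"
          using z unfolding closed_span_def closure_sequential by blast
        have "(\<lambda>n. (C + \<epsilon>) * norm (v + t n)) \<longlonglongrightarrow> (C + \<epsilon>) * norm (v + z)"
          by (intro tendsto_intros t(2))
        then show ?thesis by (rule LIMSEQ_le_const) (use fin[OF v t(1)] in blast)
      qed
      then show ?thesis by blast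
    qed
    moreover have "strict_mono (s \<circ> r)" using s r(1) by (rule strict_mono_o)
    ultimately show "\<exists>i. strict_mono i \<and> basic_sequence scl (x \<circ> i) \<and> basis_constant scl (x \<circ> i) \<le> ereal (C + \<epsilon>) \<and>
        (\<forall>F. finite_dim_subspace scl F \<and> F \<subseteq> Z \<longrightarrow>
          (\<exists>j. \<forall>v\<in>F. \<forall>z\<in>closed_span scl ((x \<circ> i) ` {k. j < k}). norm v \<le> (C + \<epsilon>) * norm (v + z)))"
      using basic by blast
  qed
  then show ?thesis
    unfolding finite_dim_separation_property_def using C(1) by (intro exI[of _ C]) auto
qed

end

end


section \<open>Greedy approximation\<close>

text \<open>Each index has finitely many predecessors in the order by decreasing weight and increasing index, so
  their number is an order embedding into the natural numbers.\<close>

lemma nat_enumeration_by_decreasing_weight: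
  fixes w :: "nat \<Rightarrow> real"
  assumes S: "infinite S"
    and fin: "\<And>j. j \<in> S \<Longrightarrow> finite {i \<in> S. w j < w i \<or> w i = w j \<and> i < j}"
  shows "\<exists>\<rho> :: nat \<Rightarrow> nat. range \<rho> = S \<and>
    (\<forall>m n. m < n \<longrightarrow> w (\<rho> n) < w (\<rho> m) \<or> w (\<rho> m) = w (\<rho> n) \<and> \<rho> m < \<rho> n)"
proof -
  define below where "below j = {i \<in> S. w j < w i \<or> w i = w j \<and> i < j}" for j
  define R where "R = (\<lambda>j. card (below j)) ` S"
  have less: "card (below i) < card (below j)" if "i \<in> S" "j \<in> S" "i \<in> below j" for i j
  proof (rule psubset_card_mono)
    show "finite (below j)" using fin[OF that(2)] by (simp add: below_def)
    show "below i \<subset> below j" using that by (auto simp: below_def)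
  qed
  have total: "i \<in> below j \<or> i = j \<or> j \<in> below i" if "i \<in> S" "j \<in> S" for i j
    using that by (auto simp: below_def)
  have inj: "inj_on (\<lambda>j. card (below j)) S"
    by (rule inj_onI) (metis less total less_irrefl)
  then have R: "infinite R" using S unfolding R_def by (simp add: finite_image_iff)
  define \<rho> where "\<rho> n = inv_into S (\<lambda>j. card (below j)) (enumerate R n)" for n
  have en: "enumerate R n \<in> (\<lambda>j. card (below j)) ` S" for n
    using enumerate_in_set[OF R] by (simp add: R_def)
  have \<rho>: "\<rho> n \<in> S" "card (below (\<rho> n)) = enumerate R n" for n
    using inv_into_into[OF en] f_inv_into_f[OF en] by (simp_all add: \<rho>_def)
  have "j \<in> range \<rho>" if "j \<in> S" for j
  proof -
    have "card (below j) \<in> R" using that by (simp add: R_def)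
    then obtain n where "enumerate R n = card (below j)"
      using enumerate_Ex[of R] R by blast
    then have "\<rho> n = j" using inj \<rho> that by (metis inj_onD)
    then show ?thesis by blast
  qed
  then have "range \<rho> = S" using \<rho>(1) by auto
  moreover have "w (\<rho> n) < w (\<rho> m) \<or> w (\<rho> m) = w (\<rho> n) \<and> \<rho> m < \<rho> n" if "m < n" for m n
  proof -
    have "card (below (\<rho> m)) < card (below (\<rho> n))"
      using enumerate_mono[OF that R] by (simp add: \<rho>(2))
    then have "\<rho> m \<in> below (\<rho> n)"
      using total[OF \<rho>(1)[of m] \<rho>(1)[of n]] less[OF \<rho>(1) \<rho>(1)] by (metis less_asym less_irrefl)
    then show ?thesis by (simp add: below_def)
  qed
  ultimately show ?thesis by blast
qed

context banach_space_over
begin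

context
  fixes x :: "nat \<Rightarrow> 'x"
  assumes fms: "fundamental_minimal_system scl x"
begin

lemmas coord = coord_simps[OF fms]

lemma is_greedy_ordering_greedy_ordering:
  assumes null: "\<And>e. 0 < e \<Longrightarrow> finite {i. e \<le> norm (coord scl x i v)}"
  shows "is_greedy_ordering scl x v (greedy_ordering scl x v)"
proof -
  define w where "w i = norm (coord scl x i v)" for i
  \<comment> \<open>A finite support is enlarged to all indices, because an ordering is a total injection.\<close>
  define S where "S = (if finite (supp scl x v) then UNIV else supp scl x v)"
  have inf: "infinite S" by (simp add: S_def)
  have fin: "finite {i \<in> S. w j < w i \<or> w i = w j \<and> i < j}" if "j \<in> S" for j
  proof (cases "w j = 0")
    case True
    then have "finite (supp scl x v)"
      using that by (auto simp: S_def supp_def w_def split: if_splits)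
    moreover have "{i \<in> S. w j < w i \<or> w i = w j \<and> i < j} \<subseteq> supp scl x v \<union> {..<j}"
      using True by (auto simp: supp_def w_def)
    ultimately show ?thesis by (meson finite_UnI finite_lessThan finite_subset)
  next
    case False
    then have "finite {i. w j \<le> norm (coord scl x i v)}"
      by (intro null) (simp add: w_def)
    then show ?thesis by (rule rev_finite_subset) (auto simp: w_def)
  qed
  have "\<exists>\<rho> :: nat \<Rightarrow> nat. range \<rho> = S \<and>
      (\<forall>m n. m < n \<longrightarrow> w (\<rho> n) < w (\<rho> m) \<or> w (\<rho> m) = w (\<rho> n) \<and> \<rho> m < \<rho> n)"
    by (rule nat_enumeration_by_decreasing_weight[of S w, OF inf]) (rule fin)
  then obtain \<rho> :: "nat \<Rightarrow> nat" where \<rho>0: "range \<rho> = S"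
    "\<forall>m n. m < n \<longrightarrow> w (\<rho> n) < w (\<rho> m) \<or> w (\<rho> m) = w (\<rho> n) \<and> \<rho> m < \<rho> n"
    by blast
  note \<rho> = \<rho>0(1) \<rho>0(2)[rule_format]
  have "inj \<rho>"
  proof (rule injI)
    fix m n assume "\<rho> m = \<rho> n"
    then show "m = n"
      using \<rho>(2)[of m n] \<rho>(2)[of n m] by (cases m n rule: linorder_cases) auto
  qed
  moreover have "supp scl x v \<subseteq> range \<rho>" using \<rho>(1) by (simp add: S_def)
  moreover have "w (\<rho> j) \<le> w (\<rho> i)" if "i \<le> j" for i j
    using \<rho>(2)[of i j] that by (cases "i = j") auto
  moreover have "\<rho> i < \<rho> j" if "i < j" "w (\<rho> i) = w (\<rho> j)" for i j
    using \<rho>(2)[OF that(1)] that(2) by simp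
  ultimately have "is_greedy_ordering scl x v \<rho>"
    unfolding is_greedy_ordering_def decreasing_ordering_def by (simp add: w_def)
  then show ?thesis unfolding greedy_ordering_def by (rule someI[of "is_greedy_ordering scl x v"])
qed

lemma greedy_approx_eq_proj:
  assumes null: "\<And>e. 0 < e \<Longrightarrow> finite {i. e \<le> norm (coord scl x i v)}"
  shows "\<exists>A. weak_thresholding_set scl x 1 v m A \<and> greedy_approx scl x m v = proj scl x A v"
proof -
  let ?\<rho> = "greedy_ordering scl x v"
  have \<rho>: "inj ?\<rho>" "supp scl x v \<subseteq> range ?\<rho>"
    "\<And>i j. i \<le> j \<Longrightarrow> norm (coord scl x (?\<rho> j) v) \<le> norm (coord scl x (?\<rho> i) v)"
    using is_greedy_ordering_greedy_ordering[OF null]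
    by (auto simp: is_greedy_ordering_def decreasing_ordering_def)
  have inj: "inj_on ?\<rho> {..<m}" using \<rho>(1) inj_on_subset by blast
  show ?thesis
  proof (intro exI conjI)
    show "weak_thresholding_set scl x 1 v m (?\<rho> ` {..<m})"
      unfolding weak_thresholding_set_def
    proof (intro conjI ballI allI impI)
      show "card (?\<rho> ` {..<m}) = m" using inj by (simp add: card_image)
      fix i j assume i: "i \<in> ?\<rho> ` {..<m}" and j: "j \<notin> ?\<rho> ` {..<m}"
      show "1 * norm (coord scl x j v) \<le> norm (coord scl x i v)"
      proof (cases "j \<in> supp scl x v")
        case True
        then obtain n where "j = ?\<rho> n" using \<rho>(2) by blast
        moreover from this have "m \<le> n" using j by (meson imageI lessThan_iff not_le)
        ultimately show ?thesis using i \<rho>(3) by auto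
      qed (simp add: supp_def)
    qed simp
    show "greedy_approx scl x m v = proj scl x (?\<rho> ` {..<m}) v"
      unfolding greedy_approx_def proj_def using inj by (simp add: sum.reindex)
  qed
qed

lemma finite_supp_span: "v \<in> span (range x) \<Longrightarrow> finite (supp scl x v)"
proof -
  assume "v \<in> span (range x)"
  from span_image_sum[OF this] obtain a n where v: "v = (\<Sum>k<n. scl (a k) (x k))" by metis
  have "coord scl x i v = 0" if "n \<le> i" for i
    unfolding v coord_sum[OF fms] using that by (intro sum.neutral) (auto simp: coord)
  then have "supp scl x v \<subseteq> {..<n}"
    by (auto simp: supp_def intro: leI ccontr)
  then show ?thesis by (rule finite_subset) simp
qed

lemma finite_supp_coords_null:
  assumes "finite (supp scl x v)" "0 < e"
  shows "finite {i. e \<le> norm (coord scl x i v)}"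
  by (rule finite_subset[OF _ assms(1)]) (use assms(2) in \<open>auto simp: supp_def\<close>)

lemma span_dense:
  assumes "0 < e"
  obtains w where "w \<in> span (range x)" "norm (v - w) < e"
proof -
  have "v \<in> closure (span (range x))"
    using fms by (simp add: fundamental_minimal_system_def fundamental_def closed_span_def)
  then obtain w where "w \<in> span (range x)" "dist w v < e"
    using assms unfolding closure_approachable by blast
  then show thesis using that by (simp add: dist_norm norm_minus_commute)
qed

text \<open>With uniformly bounded coordinate functionals, a coordinate of size \<open>e\<close> must be in the support of every
  finitely supported vector that is close enough.\<close>

lemma bounded_coordinates_null:
  assumes "bounded_coordinates scl x" "0 < e"
  shows "finite {i. e \<le> norm (coord scl x i v)}"
proof -
  obtain R where "\<And>i. onorm (coord scl x i) \<le> R"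
    using assms(1) unfolding bounded_coordinates_def bdd_above_def by auto
  moreover have "0 \<le> onorm (coord scl x 0)" by (rule onorm_pos_le[OF coord(6)])
  ultimately have R: "norm (coord scl x i u) \<le> (R + 1) * norm u" "0 < R + 1" for i u
  proof -
    assume le: "\<And>i. onorm (coord scl x i) \<le> R" and "0 \<le> onorm (coord scl x 0)"
    then show "0 < R + 1" using le[of 0] by linarith
    have "norm (coord scl x i u) \<le> onorm (coord scl x i) * norm u"
      by (rule onorm[OF coord(6)])
    also have "\<dots> \<le> (R + 1) * norm u"
      using le[of i] by (intro mult_right_mono) auto
    finally show "norm (coord scl x i u) \<le> (R + 1) * norm u" .
  qed
  obtain w where w: "w \<in> span (range x)" "norm (v - w) < e / (R + 1)"
    using span_dense[of "e / (R + 1)" v] R(2) assms(2) by auto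
  have "coord scl x i w \<noteq> 0" if "e \<le> norm (coord scl x i v)" for i
  proof
    assume "coord scl x i w = 0"
    then have "norm (coord scl x i v) \<le> (R + 1) * norm (v - w)"
      using R(1)[of i "v - w"] by (simp add: coord)
    also have "\<dots> < e" using w(2) R(2) by (simp add: pos_less_divide_eq mult.commute)
    finally show False using that by simp
  qed
  then have "{i. e \<le> norm (coord scl x i v)} \<subseteq> supp scl x w" by (auto simp: supp_def)
  then show ?thesis using finite_supp_span[OF w(1)] finite_subset by blast
qed

lemma almost_greedy_imp_quasi_greedy:
  assumes "almost_greedy scl x"
  shows "quasi_greedy scl x"
proof -
  obtain M where M: "0 < M" "\<And>v m. norm (v - greedy_approx scl x m v) \<le> M * proj_error scl x m v"
    and bc: "bounded_coordinates scl x"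
    using assms unfolding almost_greedy_def by blast
  have "proj_error scl x m v \<le> norm v" for m v
    unfolding proj_error_def
    by (rule cInf_lower) (auto simp: proj_def intro!: bdd_belowI[of _ 0] exI[of _ "{}"])
  then have "norm (v - greedy_approx scl x m v) \<le> M * norm v" for m v
    using M by (meson less_imp_le mult_left_mono order_trans)
  then have "norm (greedy_approx scl x m v) \<le> (1 + M) * norm v" for m v
    using norm_triangle_sub[of "greedy_approx scl x m v" v]
    by (simp add: distrib_right norm_minus_commute) (meson add_left_mono order_trans)
  then show ?thesis
    using fms bc M(1) unfolding quasi_greedy_def by (intro conjI exI[of _ "1 + M"]) auto
qed

text \<open>If all coordinates of \<open>v\<close> vanish and \<open>w\<close> is a finitely supported vector close to \<open>v\<close>, then \<open>w\<close> is a
  greedy approximation of the small vector \<open>w - v\<close>.\<close>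

lemma quasi_greedy_imp_markushevich_basis:
  assumes "quasi_greedy scl x"
  shows "markushevich_basis scl x"
proof -
  obtain M where M: "0 < M" "\<And>v m. 1 \<le> m \<Longrightarrow> norm (greedy_approx scl x m v) \<le> M * norm v"
    and bc: "bounded_coordinates scl x"
    using assms unfolding quasi_greedy_def by blast
  have "v = 0" if v: "\<And>i. coord scl x i v = 0" for v
  proof (rule ccontr)
    assume "v \<noteq> 0"
    then have "0 < norm v / (1 + M)" using M(1) by simp
    then obtain w where w: "w \<in> span (range x)" "norm (v - w) < norm v / (1 + M)"
      using span_dense by blast
    define m where "m = Suc (card (supp scl x w))"
    have vw: "coord scl x i (w - v) = coord scl x i w" for i by (simp add: coord v)
    obtain A where A: "weak_thresholding_set scl x 1 (w - v) m A"
      "greedy_approx scl x m (w - v) = proj scl x A (w - v)"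
      using greedy_approx_eq_proj[OF bounded_coordinates_null[OF bc]] by blast
    have fin: "finite A" "finite (supp scl x w)" "card A = m"
      using A(1) finite_supp_span[OF w(1)] by (auto simp: weak_thresholding_set_def)
    have sub: "supp scl x w \<subseteq> A"
    proof (rule ccontr)
      assume "\<not> ?thesis"
      then obtain j where j: "j \<in> supp scl x w" "j \<notin> A" by blast
      have "coord scl x i w \<noteq> 0" if "i \<in> A" for i
        using A(1) that j by (force simp: weak_thresholding_set_def vw supp_def)
      then have "A \<subseteq> supp scl x w" by (auto simp: supp_def)
      then have "card A \<le> card (supp scl x w)" using fin card_mono by blast
      then show False using fin(3) by (simp add: m_def)
    qed
    obtain a n where a: "w = (\<Sum>k<n. scl (a k) (x k))" using span_image_sum[OF w(1)] by metis
    have ca: "coord scl x i w = (if i < n then a i else 0)" for i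
    proof -
      have "coord scl x i w = (\<Sum>k<n. if k = i then a k else 0)"
        unfolding a coord_sum[OF fms] by (intro sum.cong) (auto simp: coord)
      then show ?thesis by simp
    qed
    have "w = (\<Sum>k\<in>supp scl x w. scl (coord scl x k w) (x k))"
      unfolding a[symmetric]
    proof -
      have "w = (\<Sum>k<n. scl (coord scl x k w) (x k))"
        by (subst a) (auto intro!: sum.cong simp: ca)
      also have "\<dots> = (\<Sum>k\<in>supp scl x w. scl (coord scl x k w) (x k))"
        by (rule sum.mono_neutral_right) (auto simp: supp_def ca split: if_splits)
      finally show "w = (\<Sum>k\<in>supp scl x w. scl (coord scl x k w) (x k))" .
    qed
    also have "\<dots> = proj scl x A (w - v)"
      unfolding proj_def vw using sub fin by (intro sum.mono_neutral_left) (auto simp: supp_def)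
    finally have "norm w \<le> M * norm (v - w)"
      using M(2)[of m "w - v"] A(2) by (simp add: m_def norm_minus_commute)
    moreover have "norm v \<le> norm (v - w) + norm w" by (metis diff_add_cancel norm_triangle_ineq)
    ultimately have "norm v \<le> (1 + M) * norm (v - w)" by (simp add: distrib_right)
    then show False using w(2) M(1) by (simp add: pos_less_divide_eq mult.commute)
  qed
  then show ?thesis using fms by (simp add: markushevich_basis_def total_def)
qed

end

end


section \<open>Weak semi-greedy systems with separated tails\<close>

text \<open>The part of the finite dimensional separation property that weak semi-greediness can exploit: beyond
  every finite set of indices there are blocks of any size from which a given finite-dimensional subspace is
  separated.\<close>

definition separated_tails ::
  "('k::real_or_complex_field \<Rightarrow> 'x::banach \<Rightarrow> 'x) \<Rightarrow> (nat \<Rightarrow> 'x) \<Rightarrow> real \<Rightarrow> bool"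
  where "separated_tails scl x M \<longleftrightarrow>
    (\<forall>B N m. finite B \<and> finite N \<longrightarrow>
      (\<exists>D. finite D \<and> card D = m \<and> D \<inter> N = {} \<and>
        (\<forall>v\<in>module.span scl B. \<forall>z\<in>module.span scl (x ` D). norm v \<le> M * norm (v + z))))"

lemma le_of_square_multiples:
  fixes c X :: real
  assumes "\<And>\<theta>. 1 < \<theta> \<Longrightarrow> c \<le> \<theta>\<^sup>2 * X"
  shows "c \<le> X"
proof (rule tendsto_lowerbound)
  show "((\<lambda>\<theta>. \<theta>\<^sup>2 * X) \<longlongrightarrow> X) (at_right 1)"
    by (auto intro!: tendsto_eq_intros)
  show "\<forall>\<^sub>F \<theta> in at_right 1. c \<le> \<theta>\<^sup>2 * X"
    using eventually_at_right_less[of "1::real"] by (rule eventually_mono) (rule assms)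
qed simp

lemma le_of_positive_multiples:
  fixes c X Y :: real
  assumes "\<And>\<eta>. 0 < \<eta> \<Longrightarrow> c \<le> X + \<eta> * Y"
  shows "c \<le> X"
proof (rule tendsto_lowerbound)
  show "((\<lambda>\<eta>. X + \<eta> * Y) \<longlongrightarrow> X) (at_right 0)"
    by (auto intro!: tendsto_eq_intros)
  show "\<forall>\<^sub>F \<eta> in at_right 0. c \<le> X + \<eta> * Y"
    using eventually_at_right_less[of "0::real"] by (rule eventually_mono) (rule assms)
qed simp

context banach_space_over
begin

text \<open>The space is separable, so the separation property applies to all of it.\<close>

lemma fds_with_imp_separated_tails:
  assumes fds: "fds_with scl x M" and "M < M'" and fund: "fundamental scl x"
  shows "separated_tails scl x M'"
  unfolding separated_tails_def
proof (intro allI impI, elim conjE)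
  fix B and N :: "nat set" and m assume B: "finite (B :: 'x set)" and N: "finite N"
  obtain d :: "nat \<Rightarrow> 'x" where d: "\<And>v e. 0 < e \<Longrightarrow> \<exists>n. norm (v - d n) < e"
    using fundamental_countable_dense[OF fund] by auto
  have "closure (range d) = UNIV"
    using d unfolding closure_approachable set_eq_iff dist_norm by (metis norm_minus_commute rangeI UNIV_I)
  then have "separable_space (top_of_set (UNIV :: 'x set))"
    unfolding separable_space_def by (intro exI[of _ "range d"]) auto
  then have "\<exists>i::nat \<Rightarrow> nat. strict_mono i \<and>
      (\<forall>F. finite_dim_subspace scl F \<and> F \<subseteq> UNIV \<longrightarrow>
        (\<exists>j. \<forall>v\<in>F. \<forall>z \<in> closed_span scl ((x \<circ> i) ` {k. k > j}). norm v \<le> (M + (M' - M)) * norm (v + z)))"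
    using fds[unfolded fds_with_def, rule_format, of UNIV "M' - M"] assms(2) subspace_UNIV by auto
  then obtain i where i: "strict_mono (i :: nat \<Rightarrow> nat)"
    "\<And>F. finite_dim_subspace scl F \<Longrightarrow>
        \<exists>j. \<forall>v\<in>F. \<forall>z \<in> closed_span scl ((x \<circ> i) ` {k. k > j}). norm v \<le> M' * norm (v + z)"
    by auto
  have "finite_dim_subspace scl (span B)"
    using B unfolding finite_dim_subspace_def by blast
  then obtain j where j: "\<And>v z. v \<in> span B \<Longrightarrow> z \<in> closed_span scl ((x \<circ> i) ` {k. k > j}) \<Longrightarrow>
      norm v \<le> M' * norm (v + z)"
    using i(2) by blast
  define L where "L = Suc (max j (Max (insert 0 N)))"
  have L: "n < L" if "n \<in> N" for n
    unfolding L_def using N that by (simp add: le_imp_less_Suc le_max_iff_disj)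
  let ?D = "i ` {L..<L + m}"
  have "card ?D = m"
    using strict_mono_imp_inj_on[OF i(1)] by (simp add: card_image inj_on_subset)
  moreover have "?D \<inter> N = {}"
  proof (intro equals0I, elim IntE imageE)
    fix n k assume "n \<in> N" "n = i k" "k \<in> {L..<L + m}"
    then show False using L[of n] seq_suble[OF i(1), of k] by simp
  qed
  moreover have "norm v \<le> M' * norm (v + z)" if v: "v \<in> span B" and z: "z \<in> span (x ` ?D)" for v z
  proof (rule j[OF v])
    have "x ` ?D \<subseteq> (x \<circ> i) ` {k. k > j}" by (auto simp: L_def)
    then have "span (x ` ?D) \<subseteq> span ((x \<circ> i) ` {k. k > j})" by (rule span_mono)
    then show "z \<in> closed_span scl ((x \<circ> i) ` {k. k > j})"
      unfolding closed_span_def using z closure_subset by blast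
  qed
  ultimately show "\<exists>D. finite D \<and> card D = m \<and> D \<inter> N = {} \<and>
      (\<forall>v\<in>span B. \<forall>z\<in>span (x ` D). norm v \<le> M' * norm (v + z))"
    by (intro exI[of _ ?D]) auto
qed

context
  fixes x :: "nat \<Rightarrow> 'x" and \<tau> K :: real
  assumes fms: "fundamental_minimal_system scl x"
    and \<tau>: "0 < \<tau>" "\<tau> \<le> 1"
    and wsg: "weak_semi_greedy scl x \<tau> K"
begin

lemmas coord_eqs = coord_simps[OF fms]

lemma coord_combination:
  "finite A \<Longrightarrow> coord scl x i (\<Sum>j\<in>A. scl (a j) (x j)) = (if i \<in> A then a i else 0)"
proof -
  assume "finite A"
  have "coord scl x i (\<Sum>j\<in>A. scl (a j) (x j)) = (\<Sum>j\<in>A. if j = i then a j else 0)"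
    unfolding coord_sum[OF fms] by (intro sum.cong) (auto simp: coord_eqs)
  then show ?thesis using \<open>finite A\<close> by simp
qed

lemma coord_proj: "finite A \<Longrightarrow> coord scl x i (proj scl x A v) = (if i \<in> A then coord scl x i v else 0)"
  unfolding proj_def by (rule coord_combination)

lemma combination_in_span: "(\<Sum>j\<in>A. scl (a j) (x j)) \<in> span (x ` A)"
  by (intro span_sum span_scale span_base) auto

lemma weak_semi_greedy_approx:
  assumes "1 \<le> m" "finite A" "card A \<le> m" "0 \<le> K"
  shows "\<exists>W z. weak_thresholding_set scl x \<tau> u m W \<and> z \<in> span (x ` W) \<and>
    norm (u - z) \<le> K * norm (u - (\<Sum>j\<in>A. scl (a j) (x j)))"
proof -
  let ?y = "\<Sum>j\<in>A. scl (a j) (x j)"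
  obtain W z where W: "weak_thresholding_set scl x \<tau> u m W" "z \<in> span (x ` W)"
    "norm (u - z) \<le> K * best_error scl x m u"
    using wsg assms(1) unfolding weak_semi_greedy_def by blast
  have c: "coord scl x i ?y = (if i \<in> A then a i else 0)" for i
    by (rule coord_combination[OF assms(2)])
  then have sub: "supp scl x ?y \<subseteq> A" by (auto simp: supp_def)
  have "?y = proj scl x (supp scl x ?y) ?y"
    unfolding proj_def c
    by (rule sum.mono_neutral_cong_right[OF assms(2) sub]) (auto simp: supp_def c)
  moreover have "card (supp scl x ?y) \<le> m" using card_mono[OF assms(2) sub] assms(3) by simp
  moreover have "finite (supp scl x ?y)" using sub assms(2) by (rule finite_subset)
  ultimately have "best_error scl x m u \<le> norm (u - ?y)"
    unfolding best_error_def by (intro cInf_lower bdd_belowI[of _ 0]) auto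
  then have "norm (u - z) \<le> K * norm (u - ?y)"
    using W(3) assms(4) by (meson mult_left_mono order_trans)
  then show ?thesis using W(1,2) by blast
qed

text \<open>The vector \<open>x 0 + x 1\<close> is not a multiple of a single basis vector, so its error with \<open>m = 1\<close> is
  positive, and this error is at most \<open>K\<close> times a nonnegative number.\<close>

lemma weak_semi_greedy_constant_pos: "0 < K"
proof -
  let ?v = "x 0 + x 1"
  obtain W z where W: "weak_thresholding_set scl x \<tau> ?v 1 W" "z \<in> span (x ` W)"
    "norm (?v - z) \<le> K * best_error scl x 1 ?v"
    using wsg unfolding weak_semi_greedy_def by blast
  obtain w where w: "W = {w}"
    using W(1) unfolding weak_thresholding_set_def by (metis card_1_singletonE)
  have "?v \<noteq> z"
  proof
    assume eq: "?v = z"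
    have "\<exists>c. z = scl c (x w)" using W(2) by (auto simp: w span_singleton)
    then obtain c where c: "?v = scl c (x w)" using eq by blast
    have "coord scl x 0 ?v = 1" "coord scl x 1 ?v = 1" by (simp_all add: coord_eqs)
    then show False unfolding c by (simp add: coord_eqs split: if_splits)
  qed
  then have "0 < K * best_error scl x 1 ?v" using W(3) by (smt (verit) right_minus_eq zero_less_norm_iff)
  moreover have "0 \<le> best_error scl x 1 ?v"
    unfolding best_error_def
  proof (rule cInf_greatest)
    have z: "supp scl x 0 = {}" by (simp add: supp_def coord_eqs)
    have "norm (?v - 0) \<in> {norm (?v - y) |y. finite (supp scl x y) \<and> card (supp scl x y) \<le> 1 \<and>
        y = proj scl x (supp scl x y) y}"
      by (rule CollectI, rule exI[of _ 0]) (simp add: z proj_def)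
    then show "{norm (?v - y) |y. finite (supp scl x y) \<and> card (supp scl x y) \<le> 1 \<and>
        y = proj scl x (supp scl x y) y} \<noteq> {}" by blast
  qed auto
  ultimately show ?thesis by (simp add: zero_less_mult_iff)
qed

lemma weak_thresholding_set_eq:
  assumes W: "weak_thresholding_set scl x \<tau> u (card D) W" and "finite D"
    and small: "\<And>i j. i \<notin> D \<Longrightarrow> j \<in> D \<Longrightarrow> norm (coord scl x i u) < \<tau> * norm (coord scl x j u)"
  shows "W = D"
proof (rule ccontr)
  assume ne: "W \<noteq> D"
  have W': "finite W" "card W = card D" "\<And>i j. i \<in> W \<Longrightarrow> j \<notin> W \<Longrightarrow> \<tau> * norm (coord scl x j u) \<le> norm (coord scl x i u)"
    using W unfolding weak_thresholding_set_def by auto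
  have "\<not> D \<subseteq> W" using ne W'(1,2) card_subset_eq by metis
  moreover have "\<not> W \<subseteq> D" using ne W'(2) assms(2) card_subset_eq by metis
  ultimately obtain i j where "i \<in> W" "i \<notin> D" "j \<in> D" "j \<notin> W" by blast
  then show False using W'(3) small by (metis not_less)
qed

context
  fixes M :: real
  assumes M: "0 < M" and sep: "separated_tails scl x M"
begin

lemmas K = weak_semi_greedy_constant_pos

lemma separated_set:
  assumes "finite B" "finite N"
  shows "\<exists>D. finite D \<and> card D = m \<and> D \<inter> N = {} \<and>
    (\<forall>v\<in>span B. \<forall>z\<in>span (x ` D). norm v \<le> M * norm (v + z))"
  by (rule sep[unfolded separated_tails_def, rule_format]) (simp add: assms)

text \<open>The two sums are compared through a far block \<open>D\<close> with \<open>card D = card A\<close>: one step bounds the sum over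
  \<open>A\<close> by a multiple of the block, the other bounds the block by the sum over \<open>B\<close>. The thresholds have to be
  met strictly, whence the factor \<open>\<theta> > 1\<close>, which then tends to 1.\<close>

lemma hyperdemocratic_bound:
  assumes A: "finite A" and B: "finite B" and card: "card A \<le> card B"
    and ab: "\<And>i j. i \<in> A \<Longrightarrow> j \<in> B \<Longrightarrow> norm (a i) \<le> norm (b j)"
  shows "norm (\<Sum>i\<in>A. scl (a i) (x i)) \<le> M * (M + 1) * K\<^sup>2 / \<tau>\<^sup>2 * norm (\<Sum>j\<in>B. scl (b j) (x j))"
    (is "norm ?a \<le> ?H * norm ?b")
proof -
  have H: "0 \<le> ?H" using M by simp
  have "?a = 0 \<or> (A \<noteq> {} \<and> (\<exists>\<beta>>0. (\<forall>i\<in>A. norm (a i) \<le> \<beta>) \<and> (\<forall>j\<in>B. \<beta> \<le> norm (b j))))"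
  proof (cases "A = {}")
    case Ane: False
    then have Bne: "B \<noteq> {}" using card A by auto
    define \<beta> where "\<beta> = Min ((\<lambda>j. norm (b j)) ` B)"
    have "\<beta> \<in> (\<lambda>j. norm (b j)) ` B" unfolding \<beta>_def using B Bne by (intro Min_in) auto
    then have le: "\<forall>i\<in>A. norm (a i) \<le> \<beta>" "0 \<le> \<beta>" using ab by auto
    have ge: "\<forall>j\<in>B. \<beta> \<le> norm (b j)" unfolding \<beta>_def using B by auto
    show ?thesis
    proof (cases "\<beta> = 0")
      case True
      then have "?a = 0" using le(1) by (intro sum.neutral) auto
      then show ?thesis by blast
    next
      case False
      then have "0 < \<beta>" using le(2) by simp
      then show ?thesis using Ane le(1) ge by blast
    qed
  qed simp
  then show ?thesis
  proof (elim disjE conjE exE)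
    assume "?a = 0"
    then show ?thesis using mult_nonneg_nonneg[OF H norm_ge_zero[of ?b]] by simp
  next
    fix \<beta> :: real assume Ane: "A \<noteq> {}" and \<beta>: "0 < \<beta>" "\<forall>i\<in>A. norm (a i) \<le> \<beta>" "\<forall>j\<in>B. \<beta> \<le> norm (b j)"
    have m: "1 \<le> card A" using A Ane by (simp add: Suc_le_eq card_gt_0_iff)
    have "finite (x ` (A \<union> B))" "finite (A \<union> B)" using A B by simp_all
    from separated_set[OF this, of "card A"]
    obtain D where D0: "finite D" "card D = card A" "D \<inter> (A \<union> B) = {}"
      "\<forall>v\<in>span (x ` (A \<union> B)). \<forall>z\<in>span (x ` D). norm v \<le> M * norm (v + z)"
      by blast
    note D = D0(1-3) D0(4)[rule_format]
    define d where "d = (\<Sum>j\<in>D. x j)"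
    have d: "scl c d = (\<Sum>j\<in>D. scl c (x j))" for c by (simp add: d_def scale_sum_right)
    have spanA: "?a \<in> span (x ` (A \<union> B))"
      by (rule subsetD[OF span_mono combination_in_span]) auto
    have spanB: "?b \<in> span (x ` (A \<union> B))"
      by (rule subsetD[OF span_mono combination_in_span]) auto
    have spanD: "scl c d \<in> span (x ` D)" for c unfolding d by (rule combination_in_span)
    show ?thesis
    proof (rule le_of_square_multiples)
      fix \<theta> :: real assume \<theta>: "1 < \<theta>"
      \<comment> \<open>A vector that is large enough on \<open>D\<close> has \<open>D\<close> as its only weak thresholding set.\<close>
      define \<kappa> where "\<kappa> = \<theta> * \<beta> / \<tau>"
      have \<kappa>: "0 < \<kappa>" "\<beta> < \<tau> * \<kappa>" using \<theta> \<beta>(1) \<tau> by (auto simp: \<kappa>_def)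
      let ?u = "?a + scl (of_real \<kappa>) d"
      have u: "coord scl x i ?u = (if i \<in> A then a i else 0) + (if i \<in> D then of_real \<kappa> else 0)" for i
        using A D(1) by (simp add: coord_eqs(1) d coord_combination)
      obtain W z where W: "weak_thresholding_set scl x \<tau> ?u (card A) W" "z \<in> span (x ` W)"
        "norm (?u - z) \<le> K * norm (?u - ?a)"
        using weak_semi_greedy_approx[OF m A order_refl less_imp_le[OF K], of ?u a] by blast
      have "W = D"
      proof (rule weak_thresholding_set_eq[OF _ D(1)])
        fix i j assume ij: "i \<notin> D" "j \<in> D"
        then have "norm (coord scl x j ?u) = \<kappa>" using D(3) \<kappa>(1) by (auto simp: u)
        moreover have "norm (coord scl x i ?u) \<le> \<beta>" using ij \<beta> by (auto simp: u)
        ultimately show "norm (coord scl x i ?u) < \<tau> * norm (coord scl x j ?u)" using \<kappa>(2) by simp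
      qed (use W(1) D(2) in simp)
      then have "norm ?a \<le> M * norm (?a + (scl (of_real \<kappa>) d - z))"
        using W(2) spanD by (intro D(4)[OF spanA] span_diff) auto
      also have "\<dots> \<le> M * (K * norm (scl (of_real \<kappa>) d))"
        using W(3) M by (intro mult_left_mono) (auto simp: algebra_simps)
      also have "\<dots> = M * K * \<kappa> * norm d" using \<kappa>(1) by (simp add: norm_scl)
      finally have 1: "norm ?a \<le> M * K * \<kappa> * norm d" .

      \<comment> \<open>If the block is small instead, the weak thresholding set is \<open>B\<close>.\<close>
      define \<mu> where "\<mu> = \<tau> * \<beta> / \<theta>"
      have \<mu>: "0 < \<mu>" "\<mu> < \<tau> * \<beta>" using \<theta> \<beta>(1) \<tau> by (auto simp: \<mu>_def divide_less_eq)
      let ?w = "?b + scl (of_real \<mu>) d"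
      have w: "coord scl x i ?w = (if i \<in> B then b i else 0) + (if i \<in> D then of_real \<mu> else 0)" for i
        using B D(1) by (simp add: coord_eqs(1) d coord_combination)
      obtain V y where V: "weak_thresholding_set scl x \<tau> ?w (card B) V" "y \<in> span (x ` V)"
        "norm (?w - y) \<le> K * norm (?w - scl (of_real \<mu>) d)"
        using weak_semi_greedy_approx[OF order_trans[OF m card] D(1) _ less_imp_le[OF K], of ?w "\<lambda>_. of_real \<mu>"]
          card D(2) unfolding d by auto
      have "V = B"
      proof (rule weak_thresholding_set_eq[OF V(1) B])
        fix i j assume ij: "i \<notin> B" "j \<in> B"
        then have "\<beta> \<le> norm (coord scl x j ?w)" using D(3) \<beta> by (auto simp: w)
        moreover have "norm (coord scl x i ?w) \<le> \<mu>" using ij \<mu> by (auto simp: w)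
        ultimately show "norm (coord scl x i ?w) < \<tau> * norm (coord scl x j ?w)"
          using \<mu>(2) mult_left_mono[of \<beta> "norm (coord scl x j ?w)" \<tau>] \<tau>(1) by linarith
      qed
      then have "y \<in> span (x ` B)" using V(2) by simp
      then have "y \<in> span (x ` (A \<union> B))" by (rule subsetD[OF span_mono, rotated]) auto
      from D(4)[OF span_diff[OF spanB this] spanD, of "of_real \<mu>"]
      have by_sep: "norm (?b - y) \<le> M * norm ((?b - y) + scl (of_real \<mu>) d)" .
      have "?w - y = (?b - y) + scl (of_real \<mu>) d" "?w - scl (of_real \<mu>) d = ?b" by simp_all
      then have le: "norm ((?b - y) + scl (of_real \<mu>) d) \<le> K * norm ?b" using V(3) by metis
      have "norm (?b - y) \<le> M * (K * norm ?b)"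
        by (rule order_trans[OF by_sep mult_left_mono[OF le less_imp_le[OF M]]])
      moreover have "norm (scl (of_real \<mu>) d) \<le> norm ((?b - y) + scl (of_real \<mu>) d) + norm (?b - y)"
        using norm_triangle_ineq4[of "(?b - y) + scl (of_real \<mu>) d" "?b - y"]
        by (simp only: add_diff_cancel_left')
      moreover have "norm (scl (of_real \<mu>) d) = \<mu> * norm d" using \<mu>(1) by (simp add: norm_scl)
      ultimately have "\<mu> * norm d \<le> K * norm ?b + M * (K * norm ?b)" using le by linarith
      then have 2: "\<mu> * norm d \<le> (M + 1) * K * norm ?b" by (simp only: distrib_right mult_1 mult.assoc add.commute)

      have "\<kappa> = \<theta>\<^sup>2 / \<tau>\<^sup>2 * \<mu>"
        using \<theta> \<tau>(1) by (simp add: \<kappa>_def \<mu>_def power2_eq_square)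
      then have "M * K * \<kappa> * norm d = M * K * \<theta>\<^sup>2 / \<tau>\<^sup>2 * (\<mu> * norm d)" by simp
      also have "\<dots> \<le> M * K * \<theta>\<^sup>2 / \<tau>\<^sup>2 * ((M + 1) * K * norm ?b)"
        using 2 M K by (intro mult_left_mono) auto
      also have "\<dots> = \<theta>\<^sup>2 * (?H * norm ?b)"
        by (simp add: power2_eq_square add_divide_distrib algebra_simps)
      finally show "norm ?a \<le> \<theta>\<^sup>2 * (?H * norm ?b)" using 1 by simp
    qed
  qed
qed

text \<open>This is the argument for \<open>hyperdemocratic_bound\<close> with the greedy remainder of \<open>v\<close> in place of the sum over
  \<open>A\<close> and \<open>v\<close> in place of the sum over \<open>B\<close>. The coordinates of \<open>v\<close> need not vanish on the block, but by going
  far enough out they become smaller than any \<open>\<eta>\<close>; hyperdemocracy bounds the norms of the blocks by \<open>s\<close>, so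
  that the error terms disappear as \<open>\<eta>\<close> tends to 0.\<close>

lemma greedy_remainder_bound:
  assumes null: "\<And>e. 0 < e \<Longrightarrow> finite {i. e \<le> norm (coord scl x i v)}"
    and A: "weak_thresholding_set scl x 1 v m A" and m: "1 \<le> m"
  shows "norm (v - proj scl x A v) \<le> (M * K + M * (M + 1) * K\<^sup>2 / \<tau>\<^sup>2) * norm v"
proof -
  have fA: "finite A" "card A = m" "\<And>i j. i \<in> A \<Longrightarrow> j \<notin> A \<Longrightarrow> norm (coord scl x j v) \<le> norm (coord scl x i v)"
    using A unfolding weak_thresholding_set_def by auto
  have Ane: "A \<noteq> {}" using fA m by auto
  let ?P = "proj scl x A v"
  define \<alpha> where "\<alpha> = Min ((\<lambda>i. norm (coord scl x i v)) ` A)"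
  have "\<alpha> \<in> (\<lambda>i. norm (coord scl x i v)) ` A" unfolding \<alpha>_def using fA(1) Ane by (intro Min_in) auto
  then have \<alpha>: "0 \<le> \<alpha>" "\<And>j. j \<notin> A \<Longrightarrow> norm (coord scl x j v) \<le> \<alpha>" using fA(3) by auto
  have \<alpha>A: "\<alpha> \<le> norm (coord scl x i v)" if "i \<in> A" for i unfolding \<alpha>_def using fA(1) that by auto
  \<comment> \<open>For \<open>\<alpha> = 0\<close> the defining condition would admit all indices; the empty set will do there,
    because the bound of the block by \<open>v\<close> is then trivial.\<close>
  define G where "G = (if \<alpha> = 0 then {} else {i. \<tau> * \<alpha> \<le> norm (coord scl x i v)})"
  have G: "finite G" using null[of "\<tau> * \<alpha>"] \<alpha>(1) \<tau>(1) by (auto simp: G_def)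
  define H where "H = M * (M + 1) * K\<^sup>2 / \<tau>\<^sup>2"
  define s where "s = H * norm (\<Sum>i<m. scl 1 (x i))"
  let ?Y = "M * K * (2 * s / \<tau>\<^sup>2 + 2 * s / \<tau>)"
  show ?thesis
  proof (rule le_of_positive_multiples[where Y = ?Y])
    fix \<eta> :: real assume \<eta>: "0 < \<eta>"
    let ?E = "insert v (x ` (A \<union> G))"
    have "finite ?E" "finite (A \<union> {i. \<eta> \<le> norm (coord scl x i v)})"
      using fA(1) G null[OF \<eta>] by simp_all
    from separated_set[OF this, of m]
    obtain D where D0: "finite D" "card D = m" "D \<inter> (A \<union> {i. \<eta> \<le> norm (coord scl x i v)}) = {}"
      "\<forall>v\<in>span ?E. \<forall>z\<in>span (x ` D). norm v \<le> M * norm (v + z)"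
      by blast
    note D = D0(1-3) D0(4)[rule_format]
    have D\<eta>: "i \<notin> A" "norm (coord scl x i v) \<le> \<eta>" if "i \<in> D" for i using D(3) that by auto
    define d where "d = (\<Sum>j\<in>D. x j)"
    have d: "scl c d = (\<Sum>j\<in>D. scl c (x j))" for c by (simp add: d_def scale_sum_right)
    have coord_d: "coord scl x i (scl c d) = (if i \<in> D then c else 0)" for i c
      unfolding d using D(1) by (rule coord_combination)
    have spanD: "scl c d \<in> span (x ` D)" for c unfolding d by (rule combination_in_span)
    have vE: "v \<in> span ?E" by (rule span_base) simp
    have d_le: "norm d \<le> s"
      using hyperdemocratic_bound[of D "{..<m}" "\<lambda>_. 1" "\<lambda>_. 1"] D(1,2)
      unfolding s_def H_def d_def by simp

    \<comment> \<open>One \<open>\<eta>\<close> makes up for the coordinates of \<open>v\<close> on \<open>D\<close>, the other makes the inequality strict.\<close>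
    define \<kappa> where "\<kappa> = (\<alpha> + 2 * \<eta>) / \<tau>"
    have "\<tau> * \<eta> \<le> \<eta>" using \<tau> \<eta> by simp
    then have \<kappa>: "0 < \<kappa>" "\<alpha> < \<tau> * (\<kappa> - \<eta>)"
      using \<alpha>(1) \<eta> \<tau> by (auto simp: \<kappa>_def right_diff_distrib)
    let ?u = "(v - ?P) + scl (of_real \<kappa>) d"
    have u: "coord scl x i ?u = (if i \<in> A then 0 else coord scl x i v) + (if i \<in> D then of_real \<kappa> else 0)" for i
      by (simp add: coord_eqs(1,2) coord_d coord_proj[OF fA(1)])
    have negP: "(\<Sum>j\<in>A. scl (- coord scl x j v) (x j)) = - ?P"
      by (simp add: proj_def sum_negf)
    obtain W z where W: "weak_thresholding_set scl x \<tau> ?u (card D) W" "z \<in> span (x ` W)"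
      "norm (?u - z) \<le> K * norm (?u - - ?P)"
      using weak_semi_greedy_approx[OF m fA(1) _ less_imp_le[OF K], of ?u "\<lambda>j. - coord scl x j v"]
      unfolding fA(2) D(2) negP by blast
    have "W = D"
    proof (rule weak_thresholding_set_eq[OF W(1) D(1)])
      fix i j assume ij: "i \<notin> D" "j \<in> D"
      have "\<kappa> \<le> norm (coord scl x j ?u) + norm (coord scl x j v)"
        using norm_triangle_ineq4[of "coord scl x j ?u" "coord scl x j v"] ij D\<eta>[OF ij(2)] \<kappa>(1) by (simp add: u)
      then have "\<kappa> - \<eta> \<le> norm (coord scl x j ?u)" using D\<eta>(2)[OF ij(2)] by simp
      then have "\<tau> * (\<kappa> - \<eta>) \<le> \<tau> * norm (coord scl x j ?u)" using \<tau>(1) by simp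
      moreover have "norm (coord scl x i ?u) \<le> \<alpha>" using ij \<alpha> by (simp add: u)
      ultimately show "norm (coord scl x i ?u) < \<tau> * norm (coord scl x j ?u)" using \<kappa>(2) by linarith
    qed
    have "?P \<in> span ?E"
      unfolding proj_def by (rule subsetD[OF span_mono combination_in_span]) auto
    then have "norm (v - ?P) \<le> M * norm ((v - ?P) + (scl (of_real \<kappa>) d - z))"
      using W(2) \<open>W = D\<close> by (intro D(4) span_diff vE spanD) auto
    also have "(v - ?P) + (scl (of_real \<kappa>) d - z) = ?u - z" by (simp add: algebra_simps)
    also have "M * norm (?u - z) \<le> M * (K * norm (v + scl (of_real \<kappa>) d))"
      using W(3) M by (intro mult_left_mono) (auto simp: algebra_simps)
    also have "norm (v + scl (of_real \<kappa>) d) \<le> norm v + \<kappa> * norm d"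
      using norm_triangle_ineq[of v "scl (of_real \<kappa>) d"] \<kappa>(1) by (simp add: norm_scl)
    finally have 1: "norm (v - ?P) \<le> M * (K * (norm v + \<kappa> * norm d))"
      using M K by (simp add: mult_left_mono)

    \<comment> \<open>A weak thresholding set of \<open>?w\<close> need not be \<open>A\<close>, but it avoids \<open>D\<close> and lies in the finite set
      \<open>A \<union> G\<close>, which does not depend on \<open>D\<close>.\<close>
    define \<mu> where "\<mu> = \<tau> * \<alpha> - 2 * \<eta>"
    have 2: "\<mu> * norm d \<le> (M + 1) * K * norm v"
    proof (cases "0 < \<mu>")
      case True
      then have "0 < \<tau> * \<alpha>" using \<eta> by (simp add: \<mu>_def)
      then have \<alpha>0: "\<alpha> \<noteq> 0" by auto
      let ?w = "v + scl (of_real \<mu>) d"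
      have w: "coord scl x i ?w = coord scl x i v + (if i \<in> D then of_real \<mu> else 0)" for i
        by (simp add: coord_eqs(1) coord_d)
      obtain V y where V: "weak_thresholding_set scl x \<tau> ?w m V" "y \<in> span (x ` V)"
        "norm (?w - y) \<le> K * norm (?w - scl (of_real \<mu>) d)"
        using weak_semi_greedy_approx[OF m D(1) _ less_imp_le[OF K], of ?w "\<lambda>_. of_real \<mu>"] D(2)
        unfolding d by auto
      have V': "finite V" "card V = m" using V(1) by (auto simp: weak_thresholding_set_def)
      have large: "\<tau> * \<alpha> \<le> norm (coord scl x i ?w)" if i: "i \<in> V" "i \<notin> A" for i
      proof -
        have "\<not> A \<subseteq> V" using card_subset_eq[OF V'(1), of A] V'(2) fA(2) i by auto
        then obtain a where a: "a \<in> A" "a \<notin> V" by blast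
        have "\<tau> * \<alpha> \<le> \<tau> * norm (coord scl x a v)"
          by (rule mult_left_mono[OF \<alpha>A[OF a(1)] less_imp_le[OF \<tau>(1)]])
        also have "coord scl x a v = coord scl x a ?w" using a(1) D\<eta>(1) by (auto simp: w)
        also have "\<tau> * norm (coord scl x a ?w) \<le> norm (coord scl x i ?w)"
          using V(1) i(1) a(2) unfolding weak_thresholding_set_def by blast
        finally show ?thesis .
      qed
      have "V \<subseteq> A \<union> G"
      proof
        fix i assume i: "i \<in> V"
        have "i \<notin> D"
        proof
          assume iD: "i \<in> D"
          have "norm (coord scl x i ?w) \<le> norm (coord scl x i v) + \<mu>"
            using norm_triangle_ineq[of "coord scl x i v" "of_real \<mu>"] iD True by (simp add: w)
          then show False
            using large[OF i D\<eta>(1)[OF iD]] D\<eta>(2)[OF iD] \<eta> by (simp add: \<mu>_def)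
        qed
        then show "i \<in> A \<union> G" using large[OF i] \<alpha>0 by (auto simp: G_def w)
      qed
      then have "span (x ` V) \<subseteq> span ?E" by (intro span_mono) auto
      then have "y \<in> span ?E" using V(2) by blast
      from D(4)[OF span_diff[OF vE this] spanD, of "of_real \<mu>"]
      have by_sep: "norm (v - y) \<le> M * norm ((v - y) + scl (of_real \<mu>) d)" .
      have "?w - y = (v - y) + scl (of_real \<mu>) d" "?w - scl (of_real \<mu>) d = v" by simp_all
      then have le: "norm ((v - y) + scl (of_real \<mu>) d) \<le> K * norm v" using V(3) by metis
      have "norm (v - y) \<le> M * (K * norm v)"
        by (rule order_trans[OF by_sep mult_left_mono[OF le less_imp_le[OF M]]])
      moreover have "norm (scl (of_real \<mu>) d) \<le> norm ((v - y) + scl (of_real \<mu>) d) + norm (v - y)"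
        using norm_triangle_ineq4[of "(v - y) + scl (of_real \<mu>) d" "v - y"]
        by (simp only: add_diff_cancel_left')
      moreover have "norm (scl (of_real \<mu>) d) = \<mu> * norm d" using True by (simp add: norm_scl)
      ultimately have "\<mu> * norm d \<le> K * norm v + M * (K * norm v)" using le by linarith
      then show ?thesis by (simp only: distrib_right mult_1 mult.assoc add.commute)
    next
      case False
      then have "\<mu> * norm d \<le> 0" by (simp add: mult_nonpos_nonneg)
      also have "0 \<le> (M + 1) * K * norm v" using M K by simp
      finally show ?thesis .
    qed

    have \<tau>2: "0 < \<tau>\<^sup>2" using \<tau>(1) by simp
    have "2 * \<eta> * norm d \<le> 2 * \<eta> * s" using d_le \<eta> by (intro mult_left_mono) auto
    moreover have "\<tau> * \<alpha> * norm d = \<mu> * norm d + 2 * \<eta> * norm d"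
      by (simp add: \<mu>_def left_diff_distrib)
    ultimately have "\<tau> * \<alpha> * norm d \<le> (M + 1) * K * norm v + 2 * \<eta> * s"
      using 2 by linarith
    then have "\<tau> * \<alpha> * norm d / \<tau>\<^sup>2 \<le> ((M + 1) * K * norm v + 2 * \<eta> * s) / \<tau>\<^sup>2"
      using \<tau>2 by (intro divide_right_mono) auto
    moreover have "2 * \<eta> * norm d / \<tau> \<le> 2 * \<eta> * s / \<tau>"
      using d_le \<eta> \<tau>(1) by (intro divide_right_mono mult_left_mono) auto
    moreover have "\<kappa> * norm d = \<tau> * \<alpha> * norm d / \<tau>\<^sup>2 + 2 * \<eta> * norm d / \<tau>"
      using \<tau>(1) by (simp add: \<kappa>_def power2_eq_square field_simps)
    ultimately have "\<kappa> * norm d \<le> ((M + 1) * K * norm v + 2 * \<eta> * s) / \<tau>\<^sup>2 + 2 * \<eta> * s / \<tau>"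
      by linarith
    then have "M * (K * (norm v + \<kappa> * norm d))
        \<le> M * (K * (norm v + (((M + 1) * K * norm v + 2 * \<eta> * s) / \<tau>\<^sup>2 + 2 * \<eta> * s / \<tau>)))"
      using M K by (intro mult_left_mono add_left_mono) auto
    also have "\<dots> = (M * K + M * (M + 1) * K\<^sup>2 / \<tau>\<^sup>2) * norm v + \<eta> * ?Y"
      by (simp add: add_divide_distrib power2_eq_square algebra_simps)
    finally show "norm (v - ?P) \<le> (M * K + M * (M + 1) * K\<^sup>2 / \<tau>\<^sup>2) * norm v + \<eta> * ?Y"
      using 1 by linarith
  qed
qed

text \<open>The largest coordinate of a finitely supported vector spans its first greedy approximation, and
  hyperdemocracy bounds the basis vectors away from 0.\<close>

lemma bounded_coordinates_if_separated: "bounded_coordinates scl x"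
proof -
  define C where "C = M * K + M * (M + 1) * K\<^sup>2 / \<tau>\<^sup>2"
  define H where "H = M * (M + 1) * K\<^sup>2 / \<tau>\<^sup>2"
  have CH: "0 < C" "0 < H" using M K \<tau>(1) by (auto simp: C_def H_def add_pos_pos)
  have x0: "0 < norm (x 0)" using system_nonzero[OF fms] by simp
  define R where "R = (1 + C) * H / norm (x 0)"
  have R: "0 \<le> R" using CH by (simp add: R_def)
  have fin: "norm (coord scl x i v) \<le> R * norm v" if v: "v \<in> span (range x)" for i v
  proof (cases "supp scl x v = {}")
    case True
    then show ?thesis using R by (simp add: supp_def)
  next
    case False
    have fs: "finite (supp scl x v)" by (rule finite_supp_span[OF fms v])
    let ?f = "\<lambda>i. norm (coord scl x i v)"
    have "Max (?f ` supp scl x v) \<in> ?f ` supp scl x v"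
      using fs False by (intro Max_in) auto
    then obtain k where k: "?f k = Max (?f ` supp scl x v)" by auto
    have max: "?f j \<le> ?f k" for j
    proof (cases "j \<in> supp scl x v")
      case True
      then show ?thesis unfolding k using fs by (intro Max_ge) auto
    qed (simp add: supp_def)
    then have W: "weak_thresholding_set scl x 1 v 1 {k}"
      by (simp add: weak_thresholding_set_def)
    have "norm (v - proj scl x {k} v) \<le> C * norm v"
      unfolding C_def
      by (rule greedy_remainder_bound[OF _ W]) (auto intro: finite_supp_coords_null[OF fms fs])
    then have "norm (proj scl x {k} v) \<le> (1 + C) * norm v"
      using norm_triangle_ineq4[of v "v - proj scl x {k} v"] by (simp add: distrib_right)
    then have "?f k * norm (x k) \<le> (1 + C) * norm v" by (simp add: proj_def norm_scl)
    moreover have "norm (x 0) \<le> H * norm (x k)"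
      using hyperdemocratic_bound[of "{0}" "{k}" "\<lambda>_. 1" "\<lambda>_. 1"] by (simp add: H_def)
    ultimately have "?f k * norm (x 0) \<le> H * ((1 + C) * norm v)"
      using CH(2) mult_left_mono[of "norm (x 0)" "H * norm (x k)" "?f k"]
        mult_left_mono[of "?f k * norm (x k)" "(1 + C) * norm v" H] by (simp add: algebra_simps)
    then have "?f k \<le> R * norm v" using x0 by (simp add: R_def pos_le_divide_eq algebra_simps)
    then show ?thesis using max[of i] by simp
  qed
  have all: "norm (coord scl x i v) \<le> R * norm v" for i v
  proof -
    have "v \<in> closure (span (range x))"
      using fms by (simp add: fundamental_minimal_system_def fundamental_def closed_span_def)
    then obtain t where t: "\<And>n. t n \<in> span (range x)" "t \<longlonglongrightarrow> v"
      unfolding closure_sequential by blast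
    have "(\<lambda>n. norm (coord scl x i (t n))) \<longlonglongrightarrow> norm (coord scl x i v)"
      using bounded_linear.tendsto[OF coord_eqs(6) t(2)] by (rule tendsto_norm)
    moreover have "(\<lambda>n. R * norm (t n)) \<longlonglongrightarrow> R * norm v" by (intro tendsto_intros t(2))
    ultimately show ?thesis by (rule LIMSEQ_le) (use fin[OF t(1)] in blast)
  qed
  have "onorm (coord scl x i) \<le> R" for i by (rule onorm_bound[OF R all])
  then show ?thesis unfolding bounded_coordinates_def by (intro bdd_aboveI[of _ R]) auto
qed

lemmas null = bounded_coordinates_null[OF fms bounded_coordinates_if_separated]

lemma greedy_approx_is_proj:
  "\<exists>A. weak_thresholding_set scl x 1 v m A \<and> greedy_approx scl x m v = proj scl x A v"
  by (rule greedy_approx_eq_proj[OF fms]) (rule null)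

lemma greedy_approx_bound:
  assumes "1 \<le> m"
  shows "norm (v - greedy_approx scl x m v) \<le> (M * K + M * (M + 1) * K\<^sup>2 / \<tau>\<^sup>2) * norm v"
proof -
  obtain A where A: "weak_thresholding_set scl x 1 v m A" "greedy_approx scl x m v = proj scl x A v"
    using greedy_approx_is_proj by blast
  show ?thesis unfolding A(2) by (rule greedy_remainder_bound[OF _ A(1) assms]) (rule null)
qed

text \<open>Compare a greedy set \<open>A\<close> with any \<open>B\<close> of at most the same size. The set \<open>A - B\<close> is greedy for
  \<open>v - proj scl x B v\<close>, so the projection onto it is bounded by a multiple of the norm of that
  vector; the projection onto \<open>B - A\<close> has no more and no larger coefficients than the one onto
  \<open>A - B\<close>, so hyperdemocracy applies.\<close>

lemma almost_greedy_if_separated: "almost_greedy scl x"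
proof -
  define C where "C = M * K + M * (M + 1) * K\<^sup>2 / \<tau>\<^sup>2"
  define H where "H = M * (M + 1) * K\<^sup>2 / \<tau>\<^sup>2"
  have CH: "0 < C" "0 < H" using M K \<tau>(1) by (auto simp: C_def H_def add_pos_pos)
  define R where "R = 1 + (1 + H) * (1 + C)"
  have R: "0 < R" using CH by (simp add: R_def add_pos_pos)
  have bound: "norm (v - greedy_approx scl x m v) \<le> R * norm (v - proj scl x B v)"
    if B: "finite B" "card B \<le> m" for v m B
  proof -
    obtain A where A: "weak_thresholding_set scl x 1 v m A" "greedy_approx scl x m v = proj scl x A v"
      using greedy_approx_is_proj by blast
    have fA: "finite A" "card A = m" "\<And>i j. i \<in> A \<Longrightarrow> j \<notin> A \<Longrightarrow> norm (coord scl x j v) \<le> norm (coord scl x i v)"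
      using A(1) unfolding weak_thresholding_set_def by auto
    let ?r = "v - proj scl x B v"
    have r: "coord scl x i ?r = (if i \<in> B then 0 else coord scl x i v)" for i
      by (simp add: coord_eqs(2) coord_proj[OF B(1)])
    have AB: "norm (proj scl x (A - B) v) \<le> (1 + C) * norm ?r"
    proof (cases "A - B = {}")
      case True
      then show ?thesis unfolding True proj_def using CH by simp
    next
      case False
      have W: "weak_thresholding_set scl x 1 ?r (card (A - B)) (A - B)"
        using fA by (auto simp: weak_thresholding_set_def r)
      have card: "1 \<le> card (A - B)" using False fA(1) by (simp add: Suc_le_eq card_gt_0_iff)
      have "norm (?r - proj scl x (A - B) ?r) \<le> C * norm ?r"
        unfolding C_def by (rule greedy_remainder_bound[OF _ W card]) (rule null)
      moreover have "proj scl x (A - B) ?r = proj scl x (A - B) v"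
        unfolding proj_def[of _ _ "A - B"] by (rule sum.cong) (simp_all add: r)
      ultimately have "norm (?r - proj scl x (A - B) v) \<le> C * norm ?r" by simp
      then show ?thesis
        using norm_triangle_ineq4[of ?r "?r - proj scl x (A - B) v"] by (simp add: distrib_right)
    qed
    have "card (B - A) \<le> card (A - B)"
    proof -
      have "card (B - A) + card (A \<inter> B) = card B" "card (A - B) + card (A \<inter> B) = card A"
        using card_Int_Diff[OF B(1), of A] card_Int_Diff[OF fA(1), of B] by (simp_all add: Int_commute)
      then show ?thesis using B(2) fA(2) by linarith
    qed
    then have BA: "norm (proj scl x (B - A) v) \<le> H * norm (proj scl x (A - B) v)"
      unfolding H_def proj_def using B(1) fA by (intro hyperdemocratic_bound) auto
    have split: "proj scl x A v = proj scl x (A \<inter> B) v + proj scl x (A - B) v"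
      "proj scl x B v = proj scl x (A \<inter> B) v + proj scl x (B - A) v"
      unfolding proj_def using sum.Int_Diff[OF fA(1), of _ B] sum.Int_Diff[OF B(1), of _ A]
      by (simp_all add: Int_commute)
    have "norm (v - proj scl x A v) = norm ((?r + proj scl x (B - A) v) - proj scl x (A - B) v)"
      unfolding split by (simp add: diff_diff_eq)
    then have "norm (v - proj scl x A v) \<le> norm ?r + (norm (proj scl x (B - A) v) + norm (proj scl x (A - B) v))"
      using norm_triangle_ineq4[of "?r + proj scl x (B - A) v" "proj scl x (A - B) v"]
        norm_triangle_ineq[of ?r "proj scl x (B - A) v"] by linarith
    also have "\<dots> \<le> norm ?r + (1 + H) * norm (proj scl x (A - B) v)"
      using BA by (simp add: distrib_right)
    also have "\<dots> \<le> norm ?r + (1 + H) * ((1 + C) * norm ?r)"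
      using AB CH by (intro add_left_mono mult_left_mono) auto
    finally show ?thesis unfolding A(2) by (simp add: R_def algebra_simps)
  qed
  have "norm (v - greedy_approx scl x m v) \<le> R * proj_error scl x m v" for v m
  proof -
    have "norm (v - greedy_approx scl x m v) / R \<le> proj_error scl x m v"
      unfolding proj_error_def
    proof (rule cInf_greatest)
      show "{norm (v - proj scl x A v) |A. finite A \<and> card A \<le> m} \<noteq> {}"
        by (auto intro!: exI[of _ "{}"])
      fix t assume "t \<in> {norm (v - proj scl x A v) |A. finite A \<and> card A \<le> m}"
      then show "norm (v - greedy_approx scl x m v) / R \<le> t"
        using bound R by (auto simp: pos_divide_le_eq mult.commute)
    qed
    then show ?thesis using R by (simp add: pos_divide_le_eq mult.commute)
  qed
  then show ?thesis
    unfolding almost_greedy_def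
    using fms bounded_coordinates_if_separated R by (intro conjI exI[of _ R] allI) simp_all
qed

lemma second_quasi_greedy_constant_le:
  "second_quasi_greedy_constant scl x \<le> M * K + M * (M + 1) * K\<^sup>2 / \<tau>\<^sup>2"
  unfolding second_quasi_greedy_constant_def
proof (rule cInf_lower)
  have "0 < M * K + M * (M + 1) * K\<^sup>2 / \<tau>\<^sup>2" using M K \<tau>(1) by (auto simp: add_pos_pos)
  then show "M * K + M * (M + 1) * K\<^sup>2 / \<tau>\<^sup>2
      \<in> {M. 0 < M \<and> (\<forall>v. \<forall>m\<ge>1. norm (v - greedy_approx scl x m v) \<le> M * norm v)}"
    using greedy_approx_bound by auto
qed (auto intro!: bdd_belowI[of _ 0])

lemma hyperdemocratic_if_separated:
  "0 < M * (M + 1) * K\<^sup>2 / \<tau>\<^sup>2" "hyperdemocratic_with scl x (M * (M + 1) * K\<^sup>2 / \<tau>\<^sup>2)"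
  using M K \<tau>(1) hyperdemocratic_bound unfolding hyperdemocratic_with_def by auto

lemma hyperdemocracy_constant_le: "hyperdemocracy_constant scl x \<le> M * (M + 1) * K\<^sup>2 / \<tau>\<^sup>2"
  unfolding hyperdemocracy_constant_def
  using hyperdemocratic_if_separated by (intro cInf_lower bdd_belowI[of _ 0]) auto

end

end

end

section \<open>The equivalence and the constants\<close>

theorem theorem4p2:
  fixes scl :: "'k::real_or_complex_field \<Rightarrow> 'x::banach \<Rightarrow> 'x"
    and x :: "nat \<Rightarrow> 'x" and \<tau> K :: real
  assumes "banach_space_over scl"
    and "\<not> finite_dim_subspace scl (UNIV :: 'x set)"
    and "0 < \<tau>" and "\<tau> \<le> 1"
    and "fundamental_minimal_system scl x"
    and "weak_semi_greedy scl x \<tau> K"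
  shows "(almost_greedy scl x \<longleftrightarrow> quasi_greedy scl x) \<and>
    (quasi_greedy scl x \<longleftrightarrow> markushevich_basis scl x) \<and>
    (markushevich_basis scl x \<longleftrightarrow> finite_dim_separation_property scl x) \<and>
    (almost_greedy scl x \<or> quasi_greedy scl x \<or> markushevich_basis scl x \<or>
       finite_dim_separation_property scl x \<longrightarrow>
     (let Mfs = finite_dim_separation_constant scl x in
        second_quasi_greedy_constant scl x \<le> Mfs * K + Mfs * (Mfs + 1) * K\<^sup>2 / \<tau>\<^sup>2 \<and>
        hyperdemocratic scl x \<and>
        hyperdemocracy_constant scl x \<le> Mfs * (Mfs + 1) * K\<^sup>2 / \<tau>\<^sup>2))"
proof -
  interpret V: banach_space_over scl by fact
  note wsg = assms(5,3,4,6)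
  have fund: "fundamental scl x" using assms(5) by (simp add: fundamental_minimal_system_def)
  have 1: "almost_greedy scl x \<Longrightarrow> quasi_greedy scl x"
    by (rule V.almost_greedy_imp_quasi_greedy[OF assms(5)])
  have 2: "quasi_greedy scl x \<Longrightarrow> markushevich_basis scl x"
    by (rule V.quasi_greedy_imp_markushevich_basis[OF assms(5)])
  have 3: "markushevich_basis scl x \<Longrightarrow> finite_dim_separation_property scl x"
    by (rule V.markushevich_basis_imp_fds[OF assms(5)]) (simp add: markushevich_basis_def)
  have sep: "separated_tails scl x M'" if "fds_with scl x M" "M < M'" for M M'
    by (rule V.fds_with_imp_separated_tails[OF that fund])
  have 4: "almost_greedy scl x" if fds: "finite_dim_separation_property scl x"
  proof -
    obtain M where M: "0 < M" "fds_with scl x M"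
      using fds unfolding finite_dim_separation_property_def by blast
    show ?thesis
      by (rule V.almost_greedy_if_separated[OF wsg _ sep[OF M(2), of "M + 1"]]) (use M(1) in auto)
  qed
  have 5: "let Mfs = finite_dim_separation_constant scl x in
        second_quasi_greedy_constant scl x \<le> Mfs * K + Mfs * (Mfs + 1) * K\<^sup>2 / \<tau>\<^sup>2 \<and>
        hyperdemocratic scl x \<and>
        hyperdemocracy_constant scl x \<le> Mfs * (Mfs + 1) * K\<^sup>2 / \<tau>\<^sup>2"
    if fds: "finite_dim_separation_property scl x"
  proof -
    define Mfs where "Mfs = finite_dim_separation_constant scl x"
    have ne: "{M. 0 < M \<and> fds_with scl x M} \<noteq> {}"
      using fds unfolding finite_dim_separation_property_def by blast
    have sepM: "0 < M \<and> separated_tails scl x M" if M: "Mfs < M" for M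
    proof -
      obtain M0 where "0 < M0" "fds_with scl x M0" "M0 < M"
        using cInf_lessD[OF ne M[unfolded Mfs_def finite_dim_separation_constant_def]] by auto
      then show ?thesis using sep[of M0 M] by auto
    qed
    have lim: "c \<le> f Mfs" if c: "\<And>M. 0 < M \<Longrightarrow> separated_tails scl x M \<Longrightarrow> c \<le> f M"
      and f: "isCont f Mfs" for c :: real and f
    proof (rule tendsto_lowerbound)
      show "(f \<longlongrightarrow> f Mfs) (at_right Mfs)"
        using f by (simp add: isCont_def filterlim_at_split)
      show "\<forall>\<^sub>F M in at_right Mfs. c \<le> f M"
        using eventually_at_right_less[of Mfs] by (rule eventually_mono) (use c sepM in blast)
    qed simp
    have "second_quasi_greedy_constant scl x \<le> Mfs * K + Mfs * (Mfs + 1) * K\<^sup>2 / \<tau>\<^sup>2"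
    proof (rule lim[where f = "\<lambda>M. M * K + M * (M + 1) * K\<^sup>2 / \<tau>\<^sup>2"])
      show "second_quasi_greedy_constant scl x \<le> M * K + M * (M + 1) * K\<^sup>2 / \<tau>\<^sup>2"
        if "0 < M" "separated_tails scl x M" for M
        using that by (rule V.second_quasi_greedy_constant_le[OF wsg])
      show "isCont (\<lambda>M. M * K + M * (M + 1) * K\<^sup>2 / \<tau>\<^sup>2) Mfs"
        using assms(3) by (intro continuous_intros) simp
    qed
    moreover have "hyperdemocracy_constant scl x \<le> Mfs * (Mfs + 1) * K\<^sup>2 / \<tau>\<^sup>2"
    proof (rule lim[where f = "\<lambda>M. M * (M + 1) * K\<^sup>2 / \<tau>\<^sup>2"])
      show "hyperdemocracy_constant scl x \<le> M * (M + 1) * K\<^sup>2 / \<tau>\<^sup>2"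
        if "0 < M" "separated_tails scl x M" for M
        using that by (rule V.hyperdemocracy_constant_le[OF wsg])
      show "isCont (\<lambda>M. M * (M + 1) * K\<^sup>2 / \<tau>\<^sup>2) Mfs"
        using assms(3) by (intro continuous_intros) simp
    qed
    moreover have "hyperdemocratic scl x"
      using V.hyperdemocratic_if_separated[OF wsg, of "Mfs + 1"] sepM[of "Mfs + 1"]
      unfolding hyperdemocratic_def by auto
    ultimately show ?thesis by (simp add: Let_def Mfs_def)
  qed
  show ?thesis using 1 2 3 4 5 by blast
qed

end
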